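(* Let $m,n\ge 1$ be integers and let $\alpha>1$ be real. Let $x_1<\dots<x_n$ be the positive zeros of the exceptional Laguerre polynomial of the first kind $L_{m,m+n}^{I,(\alpha)}$, let $q(x)=\prod_{k=1}^n(x-x_k)$ and $l_k(x)=\dfrac{q(x)}{q'(x_k)(x-x_k)}$ for $k=1,\dots,n$. Then the Grünwald operator on the nodes $x_1,\dots,x_n$, i.e. the interpolatory system $l_1^2,\dots,l_n^2$, is $v_{m,n}^{(\alpha+1)}$-stable on $(0,\infty)$, and it is also most economical.
   Context: $L_k^{(a)}$ denotes the classical Laguerre polynomial of degree $k$ with parameter $a$ (leading coefficient $(-1)^k/k!$), satisfying $xy''+(a+1-x)y'+ky=0$. Exceptional Laguerre polynomials of the first kind of codimension $m\ge1$: for $\alpha>0$ and $n\ge 0$, with $S(x)=L_m^{(\alpha-1)}(-x)$, $L_{m,m+n}^{I,(\alpha)}$ is the polynomial of degree $m+n$ with leading coefficient $\frac{(-1)^n}{m!\,n!}$ which satisfies $$y''(x)+\left(\frac{\alpha+1-x}{x}-\frac{2S'(x)}{S(x)}\right)y'(x)+\left(\frac{m+n}{x}-\frac{\alpha}{x}\frac{2S'(x)}{S(x)}\right)y(x)=0$$ (away from $0$ and the zeros of $S$); these conditions determine it uniquely. It is known that for $\alpha>0$ it has exactly $m$ simple zeros $z_{m,n,1}>\dots>z_{m,n,m}$ in $(-\infty,0)$ and exactly $n$ simple zeros in $(0,\infty)$. Put $P_{m,n}(x)=\frac1{m!}\prod_{i=1}^m(x-z_{m,n,i})$ and $$v_{m,n}^{(\alpha+1)}(x)=\frac{x^{\alpha+1}e^{-x}P_{m,n}(x)^2}{S(x)^2},\qquad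 x\in(0,\infty).$$ Stability: let $w$ be a positive weight on $(a,b)$ and $x_1,\dots,x_n\in(a,b)$ distinct nodes. An interpolatory system is a family of polynomials $\hat l_1,\dots,\hat l_n$ (of arbitrary degrees) with $\hat l_k(x_i)=\delta_{ki}$. It is $w$-stable on $(a,b)$ if for all $y_1,\dots,y_n\ge 0$ $$0\le w(x)\sum_{k=1}^n\frac{\hat l_k(x)}{w(x_k)}y_k\le\max_k y_k,\qquad x\in(a,b).$$ A $w$-stable interpolatory system on $(a,b)$ is most economical if $\sum_{k=1}^n\deg\hat l_k$ is minimal among $w$-stable interpolatory systems on $(a,b)$ for these nodes. The Grünwald operator on the nodes $x_1,\dots,x_n$ is $Y_n(f,x)=\sum_{k=1}^n l_k^2(x)f(x_k)$, where $l_k$ are the fundamental Lagrange polynomials. *)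

theory Defs
  imports Complex_Main "HOL-Computational_Algebra.Polynomial"
begin

definition laguerre :: "nat \<Rightarrow> real \<Rightarrow> real poly" where
  "laguerre k a = (\<Sum>j\<le>k. monom ((-1) ^ j * ((real k + a) gchoose (k - j)) / fact j) j)"

text \<open>The denominator polynomial: \<open>laguerre_S m \<alpha>\<close> is the Laguerre polynomial of
  degree \<open>m\<close> and parameter \<open>\<alpha> - 1\<close>, evaluated at \<open>-x\<close>.\<close>

definition laguerre_S :: "nat \<Rightarrow> real \<Rightarrow> real poly" where
  "laguerre_S m \<alpha> = pcompose (laguerre m (\<alpha> - 1)) [:0, -1:]"

definition is_exceptional_laguerre_I :: "nat \<Rightarrow> nat \<Rightarrow> real \<Rightarrow> real poly \<Rightarrow> bool" where
  "is_exceptional_laguerre_I m n \<alpha> y \<longleftrightarrow>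
     degree y = m + n \<and> lead_coeff y = (-1) ^ n / (fact m * fact n) \<and>
     (\<forall>x. x \<noteq> 0 \<longrightarrow> poly (laguerre_S m \<alpha>) x \<noteq> 0 \<longrightarrow>
        poly (pderiv (pderiv y)) x
        + ((\<alpha> + 1 - x) / x
             - 2 * poly (pderiv (laguerre_S m \<alpha>)) x / poly (laguerre_S m \<alpha>) x) * poly (pderiv y) x
        + ((real m + real n) / x
             - \<alpha> / x * (2 * poly (pderiv (laguerre_S m \<alpha>)) x / poly (laguerre_S m \<alpha>) x)) * poly y x
        = 0)"

text \<open>The codimension is \<open>m\<close> and the degree is \<open>m + n\<close>; existence and uniqueness are proved
  in \<open>ex1_exceptional_laguerre_I\<close> below.\<close>

definition exceptional_laguerre_I :: "nat \<Rightarrow> nat \<Rightarrow> real \<Rightarrow> real poly" where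
  "exceptional_laguerre_I m n \<alpha> = (THE y. is_exceptional_laguerre_I m n \<alpha> y)"

text \<open>For \<open>\<alpha> > 0\<close> all zeros of the exceptional polynomial are simple, so a product over the
  set of its negative zeros counts each zero with its multiplicity.\<close>

definition exceptional_laguerre_P :: "nat \<Rightarrow> nat \<Rightarrow> real \<Rightarrow> real poly" where
  "exceptional_laguerre_P m n \<alpha> =
     smult (1 / fact m) (\<Prod>z\<in>{z. z < 0 \<and> poly (exceptional_laguerre_I m n \<alpha>) z = 0}. [:-z, 1:])"

text \<open>Beware of the shift: \<open>exceptional_weight m n \<alpha>\<close> is the weight with upper index
  \<open>\<alpha> + 1\<close>, built from the exceptional polynomial with parameter \<open>\<alpha>\<close>.\<close>

definition exceptional_weight :: "nat \<Rightarrow> nat \<Rightarrow> real \<Rightarrow> real \<Rightarrow> real" where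
  "exceptional_weight m n \<alpha> x =
     x powr (\<alpha> + 1) * exp (- x) * (poly (exceptional_laguerre_P m n \<alpha>) x)\<^sup>2
       / (poly (laguerre_S m \<alpha>) x)\<^sup>2"

text \<open>Nodes, interpolatory systems and data are indexed by \<open>{1..n}\<close>; values at other indices
  are irrelevant. In the next three definitions \<open>I\<close> is the open interval, and \<open>w\<close> and the
  \<open>x k\<close> are meant to be a positive weight on \<open>I\<close> and distinct points of \<open>I\<close>.\<close>

definition interpolatory_system :: "nat \<Rightarrow> (nat \<Rightarrow> real) \<Rightarrow> (nat \<Rightarrow> real poly) \<Rightarrow> bool" where
  "interpolatory_system n x l \<longleftrightarrow>
     (\<forall>k\<in>{1..n}. \<forall>i\<in>{1..n}. poly (l k) (x i) = (if k = i then 1 else 0))"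

definition stable_system ::
    "(real \<Rightarrow> real) \<Rightarrow> real set \<Rightarrow> nat \<Rightarrow> (nat \<Rightarrow> real) \<Rightarrow> (nat \<Rightarrow> real poly) \<Rightarrow> bool" where
  "stable_system w I n x l \<longleftrightarrow>
     interpolatory_system n x l \<and>
     (\<forall>y::nat \<Rightarrow> real. (\<forall>k\<in>{1..n}. 0 \<le> y k) \<longrightarrow>
        (\<forall>t\<in>I. 0 \<le> w t * (\<Sum>k=1..n. poly (l k) t / w (x k) * y k) \<and>
               w t * (\<Sum>k=1..n. poly (l k) t / w (x k) * y k) \<le> Max (y ` {1..n})))"

definition most_economical ::
    "(real \<Rightarrow> real) \<Rightarrow> real set \<Rightarrow> nat \<Rightarrow> (nat \<Rightarrow> real) \<Rightarrow> (nat \<Rightarrow> real poly) \<Rightarrow> bool" where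
  "most_economical w I n x l \<longleftrightarrow>
     stable_system w I n x l \<and>
     (\<forall>l'. stable_system w I n x l' \<longrightarrow> (\<Sum>k=1..n. degree (l k)) \<le> (\<Sum>k=1..n. degree (l' k)))"

definition node_poly :: "nat \<Rightarrow> (nat \<Rightarrow> real) \<Rightarrow> real poly" where
  "node_poly n x = (\<Prod>k=1..n. [:- x k, 1:])"

definition lagrange_basis :: "nat \<Rightarrow> (nat \<Rightarrow> real) \<Rightarrow> nat \<Rightarrow> real poly" where
  "lagrange_basis n x k =
     smult (1 / poly (pderiv (node_poly n x)) (x k)) (node_poly n x div [:- x k, 1:])"

definition grunwald_system :: "nat \<Rightarrow> (nat \<Rightarrow> real) \<Rightarrow> nat \<Rightarrow> real poly" where
  "grunwald_system n x k = (lagrange_basis n x k)\<^sup>2"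


subsection \<open>Basic properties of the Laguerre polynomials\<close>

lemma coeff_laguerre:
  "coeff (laguerre k a) j =
     (if j \<le> k then (-1) ^ j * ((real k + a) gchoose (k - j)) / fact j else 0)"
  by (auto simp: laguerre_def coeff_sum)

lemma degree_laguerre: "degree (laguerre k a) = k"
  by (rule antisym)
     (auto intro!: degree_le le_degree simp: coeff_laguerre)

lemma lead_coeff_laguerre: "lead_coeff (laguerre k a) = (-1) ^ k / fact k"
  by (simp add: degree_laguerre coeff_laguerre)

lemma laguerre_ode:
  "[:0, 1:] * pderiv (pderiv (laguerre k a)) + [:a + 1, -1:] * pderiv (laguerre k a)
     + smult (real k) (laguerre k a) = 0"
proof (rule poly_eqI)
  fix j
  let ?c = "coeff (laguerre k a)"
  have rec: "real (Suc j) * (real j + a + 1) * ?c (Suc j) + (real k - real j) * ?c j = 0"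
  proof -
    consider "j < k" | "j = k" | "j > k" by linarith
    then show ?thesis
    proof cases
      case 1
      define s where "s = k - Suc j"
      have s: "k - j = Suc s" "k - Suc j = s" "real s = real k - real j - 1"
        using 1 by (auto simp: s_def)
      have "(real k - real j) * ((real k + a) gchoose Suc s)
              = (real j + a + 1) * ((real k + a) gchoose s)"
        using gbinomial_mult_1[of "real k + a" s] s(3) by (simp add: algebra_simps)
      moreover define P where "P = (-1) ^ j / (fact j :: real)"
      moreover have "real (Suc j) * ?c (Suc j) = - P * ((real k + a) gchoose s)"
        using 1 s by (simp add: coeff_laguerre P_def divide_simps del: of_nat_Suc)
      moreover have "?c j = P * ((real k + a) gchoose Suc s)"
        using 1 s by (simp add: coeff_laguerre P_def)
      ultimately show ?thesis by algebra
    qed (auto simp: coeff_laguerre)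
  qed
  show "coeff ([:0, 1:] * pderiv (pderiv (laguerre k a)) + [:a + 1, -1:] * pderiv (laguerre k a)
     + smult (real k) (laguerre k a)) j = coeff 0 j"
    using rec by (cases j) (auto simp: coeff_pderiv algebra_simps)
qed

lemma laguerre_S_degree: "degree (laguerre_S m \<alpha>) = m"
  by (simp add: laguerre_S_def degree_laguerre degree_pcompose)

lemma laguerre_S_lead_coeff: "lead_coeff (laguerre_S m \<alpha>) = 1 / fact m"
proof -
  have "lead_coeff (laguerre_S m \<alpha>) = lead_coeff (laguerre m (\<alpha> - 1)) * (-1) ^ m"
    unfolding laguerre_S_def by (subst lead_coeff_comp) (auto simp: degree_laguerre)
  also have "\<dots> = 1 / fact m"
    by (subst lead_coeff_laguerre) (simp flip: power_mult_distrib)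
  finally show ?thesis .
qed

lemma laguerre_S_ode:
  "[:0, 1:] * pderiv (pderiv (laguerre_S m \<alpha>)) + [:\<alpha>, 1:] * pderiv (laguerre_S m \<alpha>)
     - smult (real m) (laguerre_S m \<alpha>) = 0"
proof -
  let ?L = "laguerre m (\<alpha> - 1)"
  have "poly ([:0, 1:] * pderiv (pderiv (laguerre_S m \<alpha>)) + [:\<alpha>, 1:] * pderiv (laguerre_S m \<alpha>)
     - smult (real m) (laguerre_S m \<alpha>)) x = 0" for x
  proof -
    have "poly ([:0, 1:] * pderiv (pderiv ?L) + [:\<alpha> - 1 + 1, -1:] * pderiv ?L + smult (real m) ?L) (-x) = 0"
      by (subst laguerre_ode) simp
    moreover have "poly (pderiv (laguerre_S m \<alpha>)) x = - poly (pderiv ?L) (-x)"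
      by (simp add: laguerre_S_def pderiv_pcompose poly_pcompose pderiv_pCons)
    moreover have "poly (pderiv (pderiv (laguerre_S m \<alpha>))) x = poly (pderiv (pderiv ?L)) (-x)"
      by (simp add: laguerre_S_def pderiv_pcompose poly_pcompose pderiv_pCons pderiv_mult pderiv_minus)
    ultimately show ?thesis by (simp add: laguerre_S_def poly_pcompose algebra_simps)
  qed
  then show ?thesis by (metis poly_all_0_iff_0)
qed


subsection \<open>Existence and uniqueness of the exceptional polynomials\<close>

text \<open>The differential equation after multiplication by \<open>x S(x)\<close>.\<close>

definition exceptional_op :: "nat \<Rightarrow> nat \<Rightarrow> real \<Rightarrow> real poly \<Rightarrow> real poly" where
  "exceptional_op m n \<alpha> y =
     (let S = laguerre_S m \<alpha> in
        [:0, 1:] * S * pderiv (pderiv y) + ([:\<alpha> + 1, -1:] * S - [:0, 2:] * pderiv S) * pderiv y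
        + (smult (real m + real n) S - smult (2 * \<alpha>) (pderiv S)) * y)"

lemma laguerre_S_nonzero: "laguerre_S m \<alpha> \<noteq> 0"
  using laguerre_S_lead_coeff[of m \<alpha>] by auto

lemma is_exceptional_laguerre_I_iff:
  "is_exceptional_laguerre_I m n \<alpha> y \<longleftrightarrow>
     degree y = m + n \<and> lead_coeff y = (-1) ^ n / (fact m * fact n) \<and> exceptional_op m n \<alpha> y = 0"
proof -
  define S where "S = laguerre_S m \<alpha>"
  have op: "poly (exceptional_op m n \<alpha> y) x = x * poly S x *
        (poly (pderiv (pderiv y)) x
        + ((\<alpha> + 1 - x) / x - 2 * poly (pderiv S) x / poly S x) * poly (pderiv y) x
        + ((real m + real n) / x - \<alpha> / x * (2 * poly (pderiv S) x / poly S x)) * poly y x)"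
    if "x \<noteq> 0" "poly S x \<noteq> 0" for x
    using that by (simp add: exceptional_op_def Let_def S_def[symmetric] field_simps)
  have fin: "finite {x. poly ([:0, 1:] * S) x = 0}"
    by (rule poly_roots_finite) (auto simp: S_def laguerre_S_nonzero)
  have "exceptional_op m n \<alpha> y = 0 \<longleftrightarrow>
      (\<forall>x. x \<noteq> 0 \<longrightarrow> poly S x \<noteq> 0 \<longrightarrow> poly (exceptional_op m n \<alpha> y) x = 0)"
  proof (intro iffI)
    assume *: "\<forall>x. x \<noteq> 0 \<longrightarrow> poly S x \<noteq> 0 \<longrightarrow> poly (exceptional_op m n \<alpha> y) x = 0"
    have "UNIV - {x. poly ([:0, 1:] * S) x = 0} \<subseteq> {x. poly (exceptional_op m n \<alpha> y) x = 0}"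
      using * by auto
    moreover have "infinite (UNIV - {x. poly ([:0, 1:] * S) x = 0})"
      using fin infinite_UNIV_char_0 by (metis Diff_infinite_finite)
    ultimately have "infinite {x. poly (exceptional_op m n \<alpha> y) x = 0}"
      using finite_subset by blast
    then show "exceptional_op m n \<alpha> y = 0" using poly_roots_finite by blast
  qed auto
  then show ?thesis
    unfolding is_exceptional_laguerre_I_def S_def[symmetric] by (auto simp: op)
qed

lemma exceptional_op_diff:
  "exceptional_op m n \<alpha> (y - z) = exceptional_op m n \<alpha> y - exceptional_op m n \<alpha> z"
  by (subst poly_eq_poly_eq_iff[symmetric])
     (simp add: fun_eq_iff exceptional_op_def Let_def pderiv_diff algebra_simps)

lemma coeff_mult_eq_0_aux:
  fixes g h :: "real poly"
  assumes "h = 0 \<or> degree h < j" "degree g \<le> e"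
  shows "coeff (h * g) (j + e) = 0"
proof (cases "h = 0")
  case False
  with assms have "degree (h * g) < j + e"
    using degree_mult_le[of h g] by linarith
  then show ?thesis by (rule coeff_eq_0)
qed simp

lemma exceptional_op_degree:
  assumes "exceptional_op m n \<alpha> d = 0" "d \<noteq> 0"
  shows "degree d = m + n"
proof -
  define S j where "S = laguerre_S m \<alpha>" and "j = degree d"
  have dS: "degree S = m" "coeff S m \<noteq> 0"
    using laguerre_S_degree[of m \<alpha>] laguerre_S_lead_coeff[of m \<alpha>] by (auto simp: S_def)
  have small: "pderiv f = 0 \<or> degree (pderiv f) < degree f" for f :: "real poly"
    by (cases "degree f = 0") (auto simp: degree_pderiv pderiv_eq_0_iff)
  have x_pderiv: "degree (pCons 0 (pderiv f)) \<le> degree f" for f :: "real poly"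
    using small[of f] by (auto simp: degree_pCons_eq_if)
  have small2: "pCons 0 (pderiv (pderiv d)) = 0 \<or> degree (pCons 0 (pderiv (pderiv d))) < j"
    using x_pderiv[of "pderiv d"] small[of d] by (auto simp: j_def)
  have sd: "pderiv d = 0 \<or> degree (pderiv d) < j" using small[of d] by (simp add: j_def)
  have sS: "pderiv S = 0 \<or> degree (pderiv S) < m" using small[of S] dS by simp
  have eq: "exceptional_op m n \<alpha> d =
     pCons 0 (pderiv (pderiv d)) * S + smult (\<alpha> + 1) (pderiv d * S)
     - smult 2 (pderiv S * pCons 0 (pderiv d)) - smult (2 * \<alpha>) (pderiv S * d)
     + (smult (real m + real n) d - pCons 0 (pderiv d)) * S"
    by (simp add: exceptional_op_def Let_def S_def[symmetric] poly_eq_poly_eq_iff[symmetric]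
                  fun_eq_iff algebra_simps)
  have "coeff ((smult (real m + real n) d - pCons 0 (pderiv d)) * S) (j + m) = 0"
  proof -
    have "coeff (pCons 0 (pderiv (pderiv d)) * S) (j + m) = 0"
      by (rule coeff_mult_eq_0_aux) (use small2 dS in auto)
    moreover have "coeff (pderiv d * S) (j + m) = 0"
      by (rule coeff_mult_eq_0_aux) (use sd dS in auto)
    moreover have "coeff (pderiv S * pCons 0 (pderiv d)) (m + j) = 0"
      by (rule coeff_mult_eq_0_aux) (use sS x_pderiv[of d] in \<open>auto simp: j_def\<close>)
    moreover have "coeff (pderiv S * d) (m + j) = 0"
      by (rule coeff_mult_eq_0_aux) (use sS in \<open>auto simp: j_def\<close>)
    moreover have "coeff (exceptional_op m n \<alpha> d) (j + m) = 0" using assms by simp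
    ultimately show ?thesis unfolding eq
      by (simp only: coeff_add coeff_diff coeff_smult add.commute[of m j])
  qed
  moreover have "coeff ((smult (real m + real n) d - pCons 0 (pderiv d)) * S) (j + m)
      = coeff (smult (real m + real n) d - pCons 0 (pderiv d)) j * coeff S m"
  proof -
    have "degree (smult (real m + real n) d - pCons 0 (pderiv d)) \<le> j"
      using x_pderiv[of d] degree_smult_le[of "real m + real n" d]
      by (intro degree_diff_le) (auto simp: j_def)
    then have "coeff (h * S) (j + m) = coeff h j * coeff S m"
      if "h = smult (real m + real n) d - pCons 0 (pderiv d)" for h
    proof (cases "degree h = j")
      case True
      then show ?thesis using coeff_mult_degree_sum[of h S] dS by simp
    next
      case False
      with \<open>degree _ \<le> j\<close> that have "degree h < j" by simp
      then show ?thesis using coeff_mult_eq_0_aux[of h j S m] dS by (simp add: coeff_eq_0)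
    qed
    then show ?thesis by simp
  qed
  moreover have "coeff (pCons 0 (pderiv d)) j = real j * coeff d j"
    by (cases j) (auto simp: coeff_pderiv)
  ultimately have "(real m + real n - real j) * coeff d j = 0"
    using dS by (simp flip: left_diff_distrib)
  moreover have "coeff d j \<noteq> 0" using assms by (simp add: j_def)
  ultimately show ?thesis by (simp add: j_def)
qed

lemma is_exceptional_laguerre_I_unique:
  assumes "is_exceptional_laguerre_I m n \<alpha> y" "is_exceptional_laguerre_I m n \<alpha> z"
  shows "y = z"
proof (rule ccontr)
  assume "y \<noteq> z"
  then have "degree (y - z) = m + n"
    using assms by (intro exceptional_op_degree[where \<alpha> = \<alpha>])
      (auto simp: is_exceptional_laguerre_I_iff exceptional_op_diff)
  moreover have "coeff (y - z) (m + n) = 0"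
    using assms unfolding is_exceptional_laguerre_I_iff by (metis coeff_diff diff_self)
  ultimately show False using \<open>y \<noteq> z\<close>
    by (metis leading_coeff_0_iff right_minus_eq)
qed

lemma is_exceptional_laguerre_I_explicit:
  fixes m n :: nat and \<alpha> :: real
  defines "S \<equiv> laguerre_S m \<alpha>" and "N \<equiv> laguerre n (\<alpha> - 1)"
  shows "is_exceptional_laguerre_I m n \<alpha> ((S + pderiv S) * N - S * pderiv N)"
proof -
  define y where "y = (S + pderiv S) * N - S * pderiv N"
  have dS: "degree S = m" "coeff S m = 1 / fact m"
    using laguerre_S_degree[of m \<alpha>] laguerre_S_lead_coeff[of m \<alpha>] by (auto simp: S_def)
  have dN: "degree N = n" "coeff N n = (-1) ^ n / fact n"
    using degree_laguerre[of n] lead_coeff_laguerre[of n] by (auto simp: N_def)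
  have small: "pderiv f = 0 \<or> degree (pderiv f) < degree f" for f :: "real poly"
    by (cases "degree f = 0") (auto simp: degree_pderiv pderiv_eq_0_iff)
  have yeq: "y = S * N + pderiv S * N - pderiv N * S" by (simp add: y_def algebra_simps)
  have c: "coeff y (m + n) = (-1) ^ n / (fact m * fact n)"
  proof -
    have "coeff (pderiv S * N) (m + n) = 0"
      by (rule coeff_mult_eq_0_aux) (use small[of S] dS dN in auto)
    moreover have "coeff (pderiv N * S) (n + m) = 0"
      by (rule coeff_mult_eq_0_aux) (use small[of N] dS dN in auto)
    moreover have "coeff (S * N) (m + n) = (-1) ^ n / (fact m * fact n)"
      using coeff_mult_degree_sum[of S N] dS dN by simp
    ultimately show ?thesis by (simp add: yeq add.commute)
  qed
  have "degree y \<le> m + n"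
  proof -
    have "degree (S * N) \<le> m + n" using degree_mult_le[of S N] dS dN by simp
    moreover have "degree (pderiv S * N) \<le> m + n"
      using degree_mult_le[of "pderiv S" N] small[of S] dS dN by auto
    moreover have "degree (pderiv N * S) \<le> m + n"
      using degree_mult_le[of "pderiv N" S] small[of N] dS dN by auto
    ultimately show ?thesis unfolding yeq by (intro degree_diff_le degree_add_le)
  qed
  moreover have "m + n \<le> degree y" by (rule le_degree) (simp add: c)
  ultimately have deg: "degree y = m + n" by simp
  have "poly (exceptional_op m n \<alpha> y) x = 0" for x
  proof -
    define s0 s1 s2 s3 where "s0 = poly S x" and "s1 = poly (pderiv S) x"
      and "s2 = poly (pderiv (pderiv S)) x" and "s3 = poly (pderiv (pderiv (pderiv S))) x"
    define t0 t1 t2 t3 where "t0 = poly N x" and "t1 = poly (pderiv N) x"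
      and "t2 = poly (pderiv (pderiv N)) x" and "t3 = poly (pderiv (pderiv (pderiv N))) x"
    note Sode = laguerre_S_ode[of m \<alpha>, folded S_def]
    note Node = laguerre_ode[of n "\<alpha> - 1", folded N_def]
    have S2: "x * s2 + (\<alpha> + x) * s1 - real m * s0 = 0"
      using arg_cong[OF Sode, of "\<lambda>p. poly p x"] by (simp add: s0_def s1_def s2_def algebra_simps)
    have S3: "x * s3 + s2 + (\<alpha> + x) * s2 + s1 - real m * s1 = 0"
      using arg_cong[OF Sode, of "\<lambda>p. poly (pderiv p) x"]
      by (simp add: s0_def s1_def s2_def s3_def pderiv_add pderiv_diff pderiv_mult pderiv_smult pderiv_pCons algebra_simps)
    have N2: "x * t2 + (\<alpha> - x) * t1 + real n * t0 = 0"
      using arg_cong[OF Node, of "\<lambda>p. poly p x"] by (simp add: t0_def t1_def t2_def algebra_simps)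
    have N3: "x * t3 + t2 + (\<alpha> - x) * t2 - t1 + real n * t1 = 0"
      using arg_cong[OF Node, of "\<lambda>p. poly (pderiv p) x"]
      by (simp add: t0_def t1_def t2_def t3_def pderiv_add pderiv_diff pderiv_mult pderiv_smult pderiv_pCons algebra_simps)
    have y0: "poly y x = (s0 + s1) * t0 - s0 * t1"
      by (simp add: y_def s0_def s1_def t0_def t1_def)
    have y1: "poly (pderiv y) x = (s1 + s2) * t0 + s0 * t1 - s0 * t2"
      by (simp add: y_def s0_def s1_def s2_def t0_def t1_def t2_def pderiv_add pderiv_diff pderiv_mult algebra_simps)
    have y2: "poly (pderiv (pderiv y)) x = (s2 + s3) * t0 + (2 * s1 + s2) * t1 + s0 * t2 - s1 * t2 - s0 * t3"
      by (simp add: y_def s0_def s1_def s2_def s3_def t0_def t1_def t2_def t3_def pderiv_add pderiv_diff pderiv_mult algebra_simps)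
    have "poly (exceptional_op m n \<alpha> y) x =
        x * s0 * ((s2 + s3) * t0 + (2 * s1 + s2) * t1 + s0 * t2 - s1 * t2 - s0 * t3)
        + ((\<alpha> + 1 - x) * s0 - 2 * x * s1) * ((s1 + s2) * t0 + s0 * t1 - s0 * t2)
        + ((real m + real n) * s0 - 2 * \<alpha> * s1) * ((s0 + s1) * t0 - s0 * t1)"
      by (simp add: exceptional_op_def Let_def S_def[symmetric] y0 y1 y2)
         (simp add: s0_def s1_def algebra_simps)
    also have "\<dots> = 0" using S2 S3 N2 N3 by algebra
    finally show ?thesis .
  qed
  then have "exceptional_op m n \<alpha> y = 0" by (metis poly_all_0_iff_0)
  with deg c show ?thesis unfolding y_def[symmetric] by (simp add: is_exceptional_laguerre_I_iff)
qed

lemma ex1_exceptional_laguerre_I: "\<exists>!y. is_exceptional_laguerre_I m n \<alpha> y"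
  using is_exceptional_laguerre_I_explicit is_exceptional_laguerre_I_unique by blast

lemma exceptional_laguerre_I:
  "is_exceptional_laguerre_I m n \<alpha> (exceptional_laguerre_I m n \<alpha>)"
  unfolding exceptional_laguerre_I_def by (rule theI'[OF ex1_exceptional_laguerre_I])

end

(* Let q be the node polynomial, P the factor carrying the negative zeros of the exceptional
   polynomial y, and w the weight. At the nodes the differential equation gives
   q''/q' = (1/w)'/(1/w), so that sum l_k^2 / w(x_k) is the Hermite interpolant of 1/w at the nodes;
   stability says that it stays below 1/w.

   For exp (c x) this holds by Rolle's theorem (even derivatives are nonnegative). The inequality
   then passes to Laplace transforms of positive measures, also after multiplication by exp x.
   Now 1/w = exp x * x^(1 - alpha) * (S / (x P))^2, and the zeros s_i of S and z_i of P satisfy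
   0 > s_0 > z_0 > s_1 > z_1 > ..., because y = S' N with N > 0 at the zeros of S. Pairing each s_i
   with the preceding zero of x P writes S / (x P) as a product of factors
   (x - s) / (x - a) = 1 + (a - s) / (x - a) with s <= a <= 0 and one factor 1 / (x - a), all of
   which are Laplace transforms of positive measures.

   Minimality: each function of a stable system is nonnegative on the half-line, so its n - 1
   zeros among the nodes are at least double. *)

theory Submission
  imports Defs "HOL-Analysis.Analysis"
begin

subsection \<open>Hermite interpolation of exponentials and of Laplace transforms\<close>

text \<open>Rolle between consecutive zeros. The new zeros avoid \<open>A\<close>, so zeros that
  \<open>f'\<close> has on \<open>A\<close> itself can be counted in addition. The bound by
  \<open>Max A\<close> serves the induction: it keeps the zero found next to the largest point apart
  from the earlier ones.\<close>

lemma rolle_zeros: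
  fixes f f' :: "real \<Rightarrow> real"
  assumes deriv: "\<And>x. (f has_real_derivative f' x) (at x)"
    and "finite A" "card A = Suc N" "\<And>x. x \<in> A \<Longrightarrow> f x = 0"
  shows "\<exists>B. finite B \<and> card B = N \<and> B \<inter> A = {} \<and> (\<forall>x\<in>B. f' x = 0 \<and> x < Max A)"
  using assms(2-4)
proof (induction N arbitrary: A)
  case 0
  then show ?case by (intro exI[of _ "{}"]) auto
next
  case (Suc N)
  define M A' where "M = Max A" and "A' = A - {M}"
  have "A \<noteq> {}" using Suc.prems by auto
  then have M: "M \<in> A" using Suc.prems by (simp add: M_def)
  have A': "finite A'" "card A' = Suc N" "\<And>x. x \<in> A' \<Longrightarrow> f x = 0"
    using Suc.prems M by (auto simp: A'_def)
  obtain B where B: "finite B" "card B = N" "B \<inter> A' = {}" "\<And>x. x \<in> B \<Longrightarrow> f' x = 0 \<and> x < Max A'"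
    using Suc.IH[OF A'] by blast
  define b where "b = Max A'"
  have "A' \<noteq> {}" using A' by auto
  then have b: "b \<in> A'" "\<And>x. x \<in> A' \<Longrightarrow> x \<le> b" using A' by (auto simp: b_def)
  have "b \<le> M" using b Suc.prems by (auto simp: M_def A'_def)
  then have "b < M" using b by (auto simp: A'_def)
  moreover have "f b = f M" using b M Suc.prems by (auto simp: A'_def)
  moreover have "continuous_on {b..M} f"
    using deriv by (meson DERIV_isCont continuous_at_imp_continuous_on)
  moreover have "f differentiable (at z)" for z
    using deriv real_differentiable_def by blast
  ultimately obtain \<xi> where \<xi>: "b < \<xi>" "\<xi> < M" "f' \<xi> = 0"
    using Rolle[of b M f] deriv DERIV_unique by (metis (no_types, lifting))
  have "\<xi> \<notin> B" using B(4) \<xi> by (force simp: b_def)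
  moreover have "(insert \<xi> B) \<inter> A = {}"
    using B \<xi> b \<open>b < M\<close> by (fastforce simp: A'_def b_def)
  moreover have "x < Max A" if "x \<in> insert \<xi> B" for x
    using that B(4) \<xi> \<open>b < M\<close> by (fastforce simp: M_def b_def)
  ultimately show ?case using B \<xi> by (intro exI[of _ "insert \<xi> B"]) auto
qed

text \<open>\<open>D\<close> lists successive derivatives. Each use of Rolle costs one zero and
  raises the order by one, so \<open>k\<close> has to vary in the induction.\<close>

lemma rolle_higher_derivative:
  fixes D :: "nat \<Rightarrow> real \<Rightarrow> real"
  assumes deriv: "\<And>k x. (D k has_real_derivative D (Suc k) x) (at x)"
    and "finite A" "card A = Suc N" "\<And>x. x \<in> A \<Longrightarrow> D k x = 0"
  shows "\<exists>x. D (k + N) x = 0"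
  using assms(2-4)
proof (induction N arbitrary: A k)
  case 0
  then show ?case by (metis Nat.add_0_right card_eq_SucD insertI1)
next
  case (Suc N)
  obtain B where "finite B" "card B = Suc N" "\<forall>x\<in>B. D (Suc k) x = 0"
    using rolle_zeros[of "D k", OF deriv Suc.prems] by auto
  then show ?case using Suc.IH[of B "Suc k"] by simp
qed

text \<open>The Hermite error formula: up to the factor \<open>1 / fact (2 * n)\<close>, the
  difference is \<open>(poly Q t)\<^sup>2\<close> times a derivative of \<open>exp (c * x)\<close>
  of even order \<open>2 * n\<close>, which is nonnegative.\<close>

lemma hermite_interpolant_le_exp:
  fixes c t :: real and p :: "real poly"
  assumes X: "finite X" "X \<noteq> {}" and deg: "degree p < 2 * card X"
    and val: "\<And>a. a \<in> X \<Longrightarrow> poly p a = exp (c * a)"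
    and der: "\<And>a. a \<in> X \<Longrightarrow> poly (pderiv p) a = c * exp (c * a)"
  shows "poly p t \<le> exp (c * t)"
proof (cases "t \<in> X")
  case True
  then show ?thesis using val by simp
next
  case False
  define Q where "Q = (\<Prod>a\<in>X. [:- a, 1:])"
  define n where "n = card X"
  have n: "n > 0" using X by (auto simp: n_def)
  have Q0: "poly Q a = 0" if "a \<in> X" for a using that X by (auto simp: Q_def poly_prod)
  have Qt: "poly Q t \<noteq> 0" using False X by (auto simp: Q_def poly_prod)
  have monic: "lead_coeff Q = 1" by (simp add: Q_def lead_coeff_prod)
  have degQ: "degree Q = n" by (simp add: Q_def degree_prod_sum_eq n_def)
  \<comment> \<open>\<open>K\<close> makes \<open>exp (c * x) - poly r x\<close> vanish at
    \<open>t\<close> too, while \<open>Q ^ 2\<close> leaves value and slope on \<open>X\<close>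
    unchanged.\<close>
  define K where "K = (exp (c * t) - poly p t) / (poly Q t)\<^sup>2"
  define r where "r = p + smult K (Q ^ 2)"
  define D where "D k x = c ^ k * exp (c * x) - poly ((pderiv ^^ k) r) x" for k x
  have deriv: "(D k has_real_derivative D (Suc k) x) (at x)" for k x
    unfolding D_def by (auto intro!: derivative_eq_intros)
  have D0: "D 0 x = 0" if "x \<in> insert t X" for x
    using that Q0 Qt val by (auto simp: D_def r_def K_def)
  have D1: "D 1 a = 0" if "a \<in> X" for a
    using that Q0 der by (auto simp: D_def r_def pderiv_add pderiv_smult power2_eq_square pderiv_mult)
  have "card (insert t X) = Suc n" "finite (insert t X)" using X False by (auto simp: n_def)
  then obtain B where B: "finite B" "card B = n" "B \<inter> insert t X = {}" "\<forall>x\<in>B. D (Suc 0) x = 0"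
    using rolle_zeros[of "D 0" "D (Suc 0)" "insert t X" n, OF deriv] D0 by blast
  \<comment> \<open>The first derivative of the difference vanishes at \<open>n\<close> Rolle points
    and on \<open>X\<close>, at \<open>2 * n\<close> points altogether; \<open>2 * n - 1\<close>
    further derivatives leave one zero.\<close>
  have "card (B \<union> X) = Suc (2 * n - 1)"
    using B X n by (subst card_Un_disjoint) (auto simp: n_def)
  then obtain \<xi> where "D (1 + (2 * n - 1)) \<xi> = 0"
    using rolle_higher_derivative[of D, OF deriv, of "B \<union> X" "2 * n - 1" 1] B X D1 by auto
  then have \<xi>: "D (2 * n) \<xi> = 0" using n by simp
  have coeffQ: "coeff (Q\<^sup>2) (2 * n) = 1"
    using monic degQ by (metis degree_power_eq lead_coeff_power leading_coeff_0_iff mult.commute one_neq_zero power_one)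
  have degr: "degree r \<le> 2 * n"
    unfolding r_def using deg degQ degree_power_le[of Q 2]
    by (intro degree_add_le) (auto simp: n_def mult.commute intro: order_trans[OF degree_smult_le])
  \<comment> \<open>\<open>p\<close> has degree below \<open>2 * n\<close> and
    \<open>Q\<^sup>2\<close> is monic of degree \<open>2 * n\<close>, so only \<open>K\<close>
    survives.\<close>
  have "(pderiv ^^ (2 * n)) r = [:fact (2 * n) * K:]"
  proof (rule poly_eqI)
    fix j
    have "coeff r (2 * n) = K" using deg coeffQ by (simp add: r_def coeff_eq_0 n_def)
    moreover have "coeff r (j + 2 * n) = 0" if "j > 0" using degr that by (intro coeff_eq_0) auto
    ultimately show "coeff ((pderiv ^^ (2 * n)) r) j = coeff [:fact (2 * n) * K:] j"
      by (cases j) (auto simp: coeff_higher_pderiv pochhammer_fact add.commute)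
  qed
  with \<xi> have "fact (2 * n) * K = (c ^ n)\<^sup>2 * exp (c * \<xi>)"
    by (simp add: D_def mult.commute power_mult[symmetric])
  also have "\<dots> \<ge> 0" by simp
  finally have "fact (2 * n) * K \<ge> 0" .
  then have "K \<ge> 0" using mult_pos_neg[of "fact (2 * n)" K] by force
  then show ?thesis using Qt by (auto simp: K_def zero_le_divide_iff)
qed

section \<open>Laplace transforms and the convex cone of dominated functions\<close>

text \<open>Substitution of \<open>u * s\<close> in Euler's integral. It exhibits
  \<open>u powr (- b)\<close> as \<open>1 / Gamma b\<close> times the Laplace transform of
  \<open>s powr (b - 1)\<close>.\<close>

lemma Gamma_integral_scaled:
  fixes b u :: real
  assumes "b > 0" "u > 0"
  shows "((\<lambda>s. s powr (b - 1) * exp (- (u * s))) has_integral Gamma b * u powr (- b)) {0..}"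
proof -
  define f where "f t = t powr (b - 1) / exp t" for t :: real
  have Gam: "(f has_integral Gamma b) {0..}"
    using Gamma_integral_real[OF assms(1)] by (simp add: f_def[abs_def])
  \<comment> \<open>The change of variables theorem asks for absolute integrability, which the sign
    of \<open>f\<close> provides.\<close>
  then have "f absolutely_integrable_on {0..}"
    by (intro nonnegative_absolutely_integrable_1) (auto simp: f_def)
  moreover have "(\<lambda>s. u * s) ` {0..} = {0..}"
    using assms by (auto intro!: image_eqI[of _ _ "x / u" for x])
  ultimately have "(\<lambda>s. \<bar>u\<bar> * f (u * s)) absolutely_integrable_on {0..} \<and>
      integral {0..} (\<lambda>s. \<bar>u\<bar> * f (u * s)) = Gamma b"
    using Gam assms
    by (subst has_absolute_integral_change_of_variables_1')
       (auto intro!: derivative_eq_intros inj_onI simp: integral_unique)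
  then have "((\<lambda>s. u * f (u * s)) has_integral Gamma b) {0..}"
    using assms by (auto simp: has_integral_iff absolutely_integrable_on_def)
  from has_integral_mult_right[OF this, of "u powr (- b)"]
  have "((\<lambda>s. u powr (- b) * (u * f (u * s))) has_integral Gamma b * u powr (- b)) {0..}"
    by (simp add: mult.commute)
  then show ?thesis
  proof (rule has_integral_eq[rotated])
    fix s :: real assume "s \<in> {0..}"
    then show "u powr (- b) * (u * f (u * s)) = s powr (b - 1) * exp (- (u * s))"
      using assms by (simp add: f_def powr_mult powr_diff powr_minus exp_minus field_simps)
  qed
qed

text \<open>The functional sends \<open>f\<close> to the sum of
  \<open>A k * f (\<xi> k) + B k * f' (\<xi> k)\<close>, and \<open>exp_le\<close> bounds it on
  \<open>exp (c * x)\<close>. In the application it evaluates the Hermite interpolant of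
  \<open>f\<close> at \<open>t\<close>.\<close>

locale exp_dominated_functional =
  fixes I :: "'i set" and \<xi> A B :: "'i \<Rightarrow> real" and t :: real
  assumes nodes_pos: "\<And>k. k \<in> I \<Longrightarrow> \<xi> k > 0" and t_pos: "t > 0"
    and exp_le: "\<And>c. (\<Sum>k\<in>I. exp (c * \<xi> k) * (A k + B k * c)) \<le> exp (c * t)"
begin

text \<open>The inequality is asked for all products \<open>exp (c * x) * f x\<close>, not for
  \<open>f\<close> alone: shifting \<open>c\<close> then gives closure under exponential factors
  and, by integration over the shift, under factors that are Laplace transforms. On the positive
  axis \<open>f'\<close> is determined by \<open>f\<close>.\<close>

definition dominated :: "(real \<Rightarrow> real) \<Rightarrow> bool" where
  "dominated f \<longleftrightarrow> (\<exists>f'. (\<forall>x>0. (f has_real_derivative f' x) (at x)) \<and>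
     (\<forall>c. (\<Sum>k\<in>I. exp (c * \<xi> k) * (A k * f (\<xi> k) + B k * (c * f (\<xi> k) + f' (\<xi> k))))
            \<le> exp (c * t) * f t))"

lemma dominated_1: "dominated (\<lambda>_. 1)"
  unfolding dominated_def using exp_le by (intro exI[of _ "\<lambda>_. 0"]) simp

text \<open>Uniqueness of derivatives replaces the hidden witness in \<open>dominated\<close> by any
  known derivative at the nodes.\<close>

lemma dominated_D:
  assumes "dominated f" and "\<And>k. k \<in> I \<Longrightarrow> (f has_real_derivative f' k) (at (\<xi> k))"
  shows "(\<Sum>k\<in>I. exp (c * \<xi> k) * (A k * f (\<xi> k) + B k * (c * f (\<xi> k) + f' k))) \<le> exp (c * t) * f t"
proof -
  obtain g where g: "\<And>x. x > 0 \<Longrightarrow> (f has_real_derivative g x) (at x)"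
    and le: "\<And>c. (\<Sum>k\<in>I. exp (c * \<xi> k) * (A k * f (\<xi> k) + B k * (c * f (\<xi> k) + g (\<xi> k))))
            \<le> exp (c * t) * f t"
    using assms(1) unfolding dominated_def by blast
  have "g (\<xi> k) = f' k" if "k \<in> I" for k
    using g[OF nodes_pos[OF that]] assms(2)[OF that] DERIV_unique by blast
  then show ?thesis using le[of c] by (simp cong: sum.cong)
qed

lemma dominated_cong:
  assumes "dominated f" and eq: "\<And>x. x > 0 \<Longrightarrow> f x = g x"
  shows "dominated g"
proof -
  obtain f' where f': "\<And>x. x > 0 \<Longrightarrow> (f has_real_derivative f' x) (at x)"
    and le: "\<And>c. (\<Sum>k\<in>I. exp (c * \<xi> k) * (A k * f (\<xi> k) + B k * (c * f (\<xi> k) + f' (\<xi> k))))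
            \<le> exp (c * t) * f t"
    using assms(1) unfolding dominated_def by blast
  have "(g has_real_derivative f' x) (at x)" if "x > 0" for x
    using has_field_derivative_transform_within_open[OF f'[OF that], of "{0<..}" g] that eq by auto
  then show ?thesis
    unfolding dominated_def using le nodes_pos eq t_pos by (intro exI[of _ f']) (auto cong: sum.cong)
qed

lemma dominated_add:
  assumes "dominated f" "dominated g"
  shows "dominated (\<lambda>x. f x + g x)"
proof -
  obtain f' where f': "\<And>x. x > 0 \<Longrightarrow> (f has_real_derivative f' x) (at x)"
    and lef: "\<And>c. (\<Sum>k\<in>I. exp (c * \<xi> k) * (A k * f (\<xi> k) + B k * (c * f (\<xi> k) + f' (\<xi> k))))
            \<le> exp (c * t) * f t"
    using assms(1) unfolding dominated_def by blast
  obtain g' where g': "\<And>x. x > 0 \<Longrightarrow> (g has_real_derivative g' x) (at x)"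
    and leg: "\<And>c. (\<Sum>k\<in>I. exp (c * \<xi> k) * (A k * g (\<xi> k) + B k * (c * g (\<xi> k) + g' (\<xi> k))))
            \<le> exp (c * t) * g t"
    using assms(2) unfolding dominated_def by blast
  show ?thesis
    unfolding dominated_def
  proof (intro exI[of _ "\<lambda>x. f' x + g' x"] conjI allI impI)
    fix c
    show "(\<Sum>k\<in>I. exp (c * \<xi> k) * (A k * (f (\<xi> k) + g (\<xi> k)) +
             B k * (c * (f (\<xi> k) + g (\<xi> k)) + (f' (\<xi> k) + g' (\<xi> k))))) \<le> exp (c * t) * (f t + g t)"
      using add_mono[OF lef[of c] leg[of c]] by (simp add: sum.distrib[symmetric] algebra_simps)
  qed (use f' g' in \<open>auto intro!: derivative_intros\<close>)
qed

lemma dominated_cmult: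
  assumes "dominated f" "r \<ge> 0"
  shows "dominated (\<lambda>x. r * f x)"
proof -
  obtain f' where f': "\<And>x. x > 0 \<Longrightarrow> (f has_real_derivative f' x) (at x)"
    and lef: "\<And>c. (\<Sum>k\<in>I. exp (c * \<xi> k) * (A k * f (\<xi> k) + B k * (c * f (\<xi> k) + f' (\<xi> k))))
            \<le> exp (c * t) * f t"
    using assms(1) unfolding dominated_def by blast
  show ?thesis
    unfolding dominated_def
  proof (intro exI[of _ "\<lambda>x. r * f' x"] conjI allI impI)
    fix c
    show "(\<Sum>k\<in>I. exp (c * \<xi> k) * (A k * (r * f (\<xi> k)) +
             B k * (c * (r * f (\<xi> k)) + r * f' (\<xi> k)))) \<le> exp (c * t) * (r * f t)"
      using mult_left_mono[OF lef[of c] assms(2)] by (simp add: sum_distrib_left algebra_simps)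
  qed (use f' in \<open>auto intro!: derivative_eq_intros\<close>)
qed

lemma dominated_exp:
  assumes "dominated f"
  shows "dominated (\<lambda>x. exp (d * x) * f x)"
proof -
  obtain f' where f': "\<And>x. x > 0 \<Longrightarrow> (f has_real_derivative f' x) (at x)"
    and lef: "\<And>c. (\<Sum>k\<in>I. exp (c * \<xi> k) * (A k * f (\<xi> k) + B k * (c * f (\<xi> k) + f' (\<xi> k))))
            \<le> exp (c * t) * f t"
    using assms(1) unfolding dominated_def by blast
  show ?thesis
    unfolding dominated_def
  proof (intro exI[of _ "\<lambda>x. exp (d * x) * (d * f x + f' x)"] conjI allI impI)
    fix c
    show "(\<Sum>k\<in>I. exp (c * \<xi> k) * (A k * (exp (d * \<xi> k) * f (\<xi> k)) +
             B k * (c * (exp (d * \<xi> k) * f (\<xi> k)) + exp (d * \<xi> k) * (d * f (\<xi> k) + f' (\<xi> k)))))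
          \<le> exp (c * t) * (exp (d * t) * f t)"
      using lef[of "c + d"] by (simp add: distrib_right exp_add algebra_simps)
  qed (use f' in \<open>auto intro!: derivative_eq_intros simp: algebra_simps\<close>)
qed

text \<open>Both sides are integrated against the measure \<open>s powr (b - 1) * exp (s * a) ds\<close>, of which
  \<open>(x - a) powr (- b)\<close> is the Laplace transform up to the factor \<open>Gamma b\<close>.\<close>

lemma dominated_powr:
  assumes "dominated f" "b > 0" "a \<le> 0"
  shows "dominated (\<lambda>x. (x - a) powr (- b) * f x)"
proof -
  obtain f' where f': "\<And>x. x > 0 \<Longrightarrow> (f has_real_derivative f' x) (at x)"
    and lef: "\<And>c. (\<Sum>k\<in>I. exp (c * \<xi> k) * (A k * f (\<xi> k) + B k * (c * f (\<xi> k) + f' (\<xi> k))))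
            \<le> exp (c * t) * f t"
    using assms(1) unfolding dominated_def by blast
  define f1 where "f1 x = (x - a) powr (- b) * f' x - b * (x - a) powr (- b - 1) * f x" for x
  show ?thesis
    unfolding dominated_def
  proof (intro exI[of _ f1] conjI allI impI)
    fix x :: real assume "x > 0"
    then have "x - a > 0" using assms by simp
    then show "((\<lambda>x. (x - a) powr (- b) * f x) has_real_derivative f1 x) (at x)"
      unfolding f1_def using f'[OF \<open>x > 0\<close>]
      by (auto intro!: derivative_eq_intros simp: algebra_simps powr_diff)
  next
    fix c
    have J0: "((\<lambda>s. s powr (b - 1) * exp (- ((x - a) * s))) has_integral Gamma b * (x - a) powr (- b)) {0..}"
      if "x > 0" for x
      using that assms by (intro Gamma_integral_scaled) auto
    \<comment> \<open>\<open>J0\<close> with \<open>b + 1\<close> in place of \<open>b\<close>; up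
      to sign this is the derivative of \<open>J0\<close> in \<open>x\<close>.\<close>
    have J1: "((\<lambda>s. s powr b * exp (- ((x - a) * s))) has_integral
        Gamma b * (b * (x - a) powr (- b - 1))) {0..}" if "x > 0" for x
      using that assms Gamma_integral_scaled[of "b + 1" "x - a"] Gamma_plus1[of b]
      by (simp add: mult_ac nonpos_Ints_def)
    \<comment> \<open>The functional applied to \<open>exp (c * x) * f x\<close> times the kernel
      \<open>s powr (b - 1) * exp (- ((x - a) * s))\<close>. Differentiating the kernel brings down
      \<open>- s\<close>, whence the power \<open>s powr b\<close>.\<close>
    define lhs where "lhs s = (\<Sum>k\<in>I. exp (c * \<xi> k) *
        (A k * f (\<xi> k) + B k * (c * f (\<xi> k) + f' (\<xi> k))) * (s powr (b - 1) * exp (- ((\<xi> k - a) * s)))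
        - exp (c * \<xi> k) * B k * f (\<xi> k) * (s powr b * exp (- ((\<xi> k - a) * s))))" for s
    have "(lhs has_integral (\<Sum>k\<in>I. exp (c * \<xi> k) *
        (A k * f (\<xi> k) + B k * (c * f (\<xi> k) + f' (\<xi> k))) * (Gamma b * (\<xi> k - a) powr (- b))
        - exp (c * \<xi> k) * B k * f (\<xi> k) * (Gamma b * (b * (\<xi> k - a) powr (- b - 1))))) {0..}"
      (is "(_ has_integral ?L) _")
      unfolding lhs_def
    \<comment> \<open>\<open>I\<close> may be infinite; both sums are then 0 by convention.\<close>
    proof (cases "finite I")
      case True
      show "((\<lambda>s. \<Sum>k\<in>I. exp (c * \<xi> k) *
        (A k * f (\<xi> k) + B k * (c * f (\<xi> k) + f' (\<xi> k))) * (s powr (b - 1) * exp (- ((\<xi> k - a) * s)))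
        - exp (c * \<xi> k) * B k * f (\<xi> k) * (s powr b * exp (- ((\<xi> k - a) * s)))) has_integral ?L) {0..}"
        by (intro has_integral_sum True has_integral_diff has_integral_mult_right J0 J1 nodes_pos)
    qed simp
    moreover have "((\<lambda>s. exp (c * t) * f t * (s powr (b - 1) * exp (- ((t - a) * s)))) has_integral
        exp (c * t) * f t * (Gamma b * (t - a) powr (- b))) {0..}"
      by (intro has_integral_mult_right J0 t_pos)
    moreover have "lhs s \<le> exp (c * t) * f t * (s powr (b - 1) * exp (- ((t - a) * s)))"
      if "s \<in> {0..}" for s
    proof -
      \<comment> \<open>At \<open>s = 0\<close> both sides are 0, since \<open>0 powr u\<close> is 0
        for every \<open>u\<close>.\<close>
      have s: "s powr b = s * s powr (b - 1)"
        using that by (cases "s = 0") (auto simp: powr_diff)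
      \<comment> \<open>The kernel only shifts \<open>c\<close> to \<open>c - s\<close>, so the
        bound \<open>lef\<close> applies under the integral for each \<open>s\<close>.\<close>
      have "lhs s = s powr (b - 1) * exp (a * s) * (\<Sum>k\<in>I. exp ((c - s) * \<xi> k) *
          (A k * f (\<xi> k) + B k * ((c - s) * f (\<xi> k) + f' (\<xi> k))))"
        unfolding lhs_def s sum_distrib_left
      proof (rule sum.cong)
        fix k
        have "exp (- ((\<xi> k - a) * s)) = exp (a * s) / exp (s * \<xi> k)"
          by (simp add: exp_diff[symmetric] algebra_simps)
        moreover have "exp ((c - s) * \<xi> k) = exp (c * \<xi> k) / exp (s * \<xi> k)"
          by (simp add: exp_diff[symmetric] algebra_simps)
        ultimately show "exp (c * \<xi> k) * (A k * f (\<xi> k) + B k * (c * f (\<xi> k) + f' (\<xi> k))) *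
            (s powr (b - 1) * exp (- ((\<xi> k - a) * s))) -
            exp (c * \<xi> k) * B k * f (\<xi> k) * (s * s powr (b - 1) * exp (- ((\<xi> k - a) * s))) =
            s powr (b - 1) * exp (a * s) * (exp ((c - s) * \<xi> k) *
            (A k * f (\<xi> k) + B k * ((c - s) * f (\<xi> k) + f' (\<xi> k))))"
          by (simp only:) (simp add: field_simps)
      qed simp
      also have "\<dots> \<le> s powr (b - 1) * exp (a * s) * (exp ((c - s) * t) * f t)"
        by (intro mult_left_mono lef) auto
      also have "exp ((c - s) * t) = exp (c * t) * exp (- ((t - a) * s)) / exp (a * s)"
        by (simp add: exp_add[symmetric] exp_diff[symmetric] algebra_simps)
      finally show ?thesis by (simp add: mult_ac)
    qed
    ultimately have "?L \<le> exp (c * t) * f t * (Gamma b * (t - a) powr (- b))"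
      by (rule has_integral_le)
    moreover have "?L = Gamma b * (\<Sum>k\<in>I. exp (c * \<xi> k) * (A k * ((\<xi> k - a) powr (- b) * f (\<xi> k)) +
           B k * (c * ((\<xi> k - a) powr (- b) * f (\<xi> k)) + f1 (\<xi> k))))"
      unfolding sum_distrib_left f1_def by (intro sum.cong) (auto simp: algebra_simps)
    moreover have "Gamma b > 0" using assms by (simp add: Gamma_real_pos)
    ultimately show "(\<Sum>k\<in>I. exp (c * \<xi> k) * (A k * ((\<xi> k - a) powr (- b) * f (\<xi> k)) +
           B k * (c * ((\<xi> k - a) powr (- b) * f (\<xi> k)) + f1 (\<xi> k))))
         \<le> exp (c * t) * ((t - a) powr (- b) * f t)"
      by (simp add: mult_ac)
  qed
qed

lemma dominated_divide:
  assumes "dominated f" "a \<le> 0"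
  shows "dominated (\<lambda>x. f x / (x - a))"
  using dominated_powr[OF assms(1) zero_less_one assms(2)]
  by (rule dominated_cong) (use assms(2) in \<open>auto simp: powr_minus divide_simps\<close>)

text \<open>From \<open>(x - s) / (x - a) = 1 + (a - s) / (x - a)\<close>, where
  \<open>s \<le> a\<close> makes the second coefficient nonnegative.\<close>

lemma dominated_quotient:
  assumes "dominated f" "s \<le> a" "a \<le> 0"
  shows "dominated (\<lambda>x. (x - s) / (x - a) * f x)"
  using dominated_add[OF assms(1) dominated_cmult[OF dominated_divide[OF assms(1,3)], of "a - s"]]
  by (rule dominated_cong) (use assms(2,3) in \<open>auto simp: field_simps\<close>)

lemma dominated_prod_quotient:
  assumes "dominated f" "finite J" "\<And>i. i \<in> J \<Longrightarrow> s i \<le> a i" "\<And>i. i \<in> J \<Longrightarrow> a i \<le> 0"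
  shows "dominated (\<lambda>x. (\<Prod>i\<in>J. (x - s i) / (x - a i)) * f x)"
  using assms(2-4)
proof (induction rule: finite_induct)
  case empty
  then show ?case using assms(1) by simp
next
  case (insert j J)
  then show ?case using dominated_quotient[of "\<lambda>x. (\<Prod>i\<in>J. (x - s i) / (x - a i)) * f x" "s j" "a j"]
    by (simp add: mult.assoc)
qed

end

subsection \<open>Zeros of the Laguerre and exceptional Laguerre polynomials\<close>

lemma poly_pderiv_prod_linear:
  fixes x :: "'i \<Rightarrow> 'a :: idom"
  assumes "finite I" "i \<in> I"
  shows "poly (pderiv (\<Prod>j\<in>I. [:- x j, 1:])) (x i) = (\<Prod>j\<in>I - {i}. x i - x j)"
proof -
  define R where "R = (\<Prod>j\<in>I - {i}. [:- x j, 1:])"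
  have "(\<Prod>j\<in>I. [:- x j, 1:]) = [:- x i, 1:] * R"
    using assms unfolding R_def by (rule prod.remove)
  then have "poly (pderiv (\<Prod>j\<in>I. [:- x j, 1:])) (x i) = poly R (x i)"
    by (simp only: pderiv_mult) (simp add: pderiv_pCons)
  then show ?thesis by (simp add: R_def poly_prod)
qed

lemma degree_prod_linear: "degree (\<Prod>j\<in>I. [:- x j, 1 :: 'a :: idom:]) = card I"
  by (simp add: degree_prod_sum_eq)

text \<open>The two sides have the same leading coefficient and agree at \<open>degree p\<close>
  distinct points.\<close>

lemma poly_eq_smult_prod_roots:
  fixes p :: "'a :: idom poly"
  assumes "finite I" "inj_on z I" "card I = degree p" "\<And>i. i \<in> I \<Longrightarrow> poly p (z i) = 0"
  shows "p = smult (lead_coeff p) (\<Prod>i\<in>I. [:- z i, 1:])"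
proof (rule poly_eqI_degree_lead_coeff[where A = "z ` I" and n = "degree p"])
  have "lead_coeff (\<Prod>i\<in>I. [:- z i, 1:]) = 1" by (simp add: lead_coeff_prod)
  then show "lead_coeff p = coeff (smult (lead_coeff p) (\<Prod>i\<in>I. [:- z i, 1:])) (degree p)"
    using assms(3) by (simp add: degree_prod_linear)
  show "poly p a = poly (smult (lead_coeff p) (\<Prod>i\<in>I. [:- z i, 1:])) a" if "a \<in> z ` I" for a
    using that assms by (auto simp: poly_prod)
qed (use assms in \<open>auto simp: card_image degree_prod_linear intro: order_trans[OF degree_smult_le]\<close>)

text \<open>The derivative at \<open>s i\<close> is the product of the differences
  \<open>s i - s j\<close>, and exactly the \<open>i\<close> factors with \<open>j < i\<close> are
  negative.\<close>

lemma sign_pderiv_prod_linear: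
  fixes s :: "nat \<Rightarrow> real"
  assumes dec: "\<And>i j. i < j \<Longrightarrow> j < m \<Longrightarrow> s j < s i" and "i < m"
  shows "(-1) ^ i * poly (pderiv (\<Prod>j<m. [:- s j, 1:])) (s i) > 0"
proof -
  have split: "{..<m} - {i} = {..<i} \<union> {i<..<m}" using \<open>i < m\<close> by auto
  have "(-1) ^ i * poly (pderiv (\<Prod>j<m. [:- s j, 1:])) (s i) =
      ((-1) ^ i * (\<Prod>j<i. s i - s j)) * (\<Prod>j\<in>{i<..<m}. s i - s j)"
    using \<open>i < m\<close>
    by (subst poly_pderiv_prod_linear, simp, simp, subst split, subst prod.union_disjoint) auto
  also have "(-1) ^ i * (\<Prod>j<i. s i - s j) = (\<Prod>j<i. (-1) * (s i - s j))"
    by (subst prod.distrib) simp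
  also have "\<dots> = (\<Prod>j<i. s j - s i)" by simp
  also have "\<dots> * (\<Prod>j\<in>{i<..<m}. s i - s j) > 0"
    using dec \<open>i < m\<close> by (intro mult_pos_pos prod_pos) auto
  finally show ?thesis .
qed

text \<open>The intermediate value theorem gives a zero in each gap; the gaps are disjoint, which
  orders the zeros.\<close>

lemma poly_zeros_between_sign_changes:
  fixes g :: "real poly"
  assumes dec: "\<And>i j. i < j \<Longrightarrow> j \<le> m \<Longrightarrow> r j < r i"
    and sign: "\<And>i. i \<le> m \<Longrightarrow> (-1) ^ i * poly g (r i) > 0"
  shows "\<exists>z. (\<forall>i<m. r (Suc i) < z i \<and> z i < r i \<and> poly g (z i) = 0) \<and>
             (\<forall>i j. i < j \<longrightarrow> j < m \<longrightarrow> z j < z i)"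
proof -
  have "\<exists>z. r (Suc i) < z \<and> z < r i \<and> poly g z = 0" if "i < m" for i
  proof -
    have "poly g (r (Suc i)) * poly g (r i) < 0"
      using sign[of "Suc i"] sign[of i] that by (cases "even i") (auto simp: mult_less_0_iff)
    then show ?thesis using poly_IVT[of "r (Suc i)" "r i" g] dec[of i "Suc i"] that by auto
  qed
  then obtain z where z: "\<And>i. i < m \<Longrightarrow> r (Suc i) < z i \<and> z i < r i \<and> poly g (z i) = 0"
    by metis
  moreover have "z j < z i" if "i < j" "j < m" for i j
  proof -
    have "r j \<le> r (Suc i)" using that dec[of "Suc i" j] by (cases "j = Suc i") auto
    then show ?thesis using z[of i] z[of j] that by linarith
  qed
  ultimately show ?thesis by blast
qed

text \<open>The reflection \<open>x -> - x\<close> turns this into positivity near plus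
  infinity.\<close>

lemma poly_pos_far_left:
  fixes p :: "real poly"
  assumes "(-1) ^ degree p * lead_coeff p > 0"
  shows "\<exists>x<b. poly p x > 0"
proof -
  define q where "q = pcompose p [:0, -1:]"
  have "lead_coeff q = lead_coeff p * (-1) ^ degree p"
    unfolding q_def by (subst lead_coeff_comp) auto
  then have pos: "lead_coeff q > 0" using assms by (simp add: mult.commute)
  then obtain c where c: "\<And>x. x \<ge> c \<Longrightarrow> lead_coeff q \<le> poly q x"
    using poly_pinfty_gt_lc[of q] by blast
  define x where "x = max c (1 - b)"
  have "poly p (- x) > 0" using c[of x] pos by (simp add: q_def poly_pcompose x_def)
  moreover have "- x < b" by (simp add: x_def)
  ultimately show ?thesis by blast
qed

section \<open>Zeros of \<open>S\<close> and negative zeros of the exceptional polynomials\<close>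

text \<open>The raising relation from degree \<open>k\<close> and parameter \<open>a + 1\<close> to
  degree \<open>Suc k\<close> and parameter \<open>a\<close>; in coefficients it amounts to the
  binomial recurrence \<open>rec\<close>. It drives the induction for the zeros.\<close>

lemma laguerre_Suc:
  "smult (real (Suc k)) (laguerre (Suc k) a) =
     [:0, 1:] * pderiv (laguerre k (a + 1)) + [:a + 1, -1:] * laguerre k (a + 1)"
proof (rule poly_eqI)
  fix j
  define A where "A = real k + a + 1"
  have cL: "coeff (laguerre k (a + 1)) j = (if j \<le> k then (-1) ^ j * (A gchoose (k - j)) / fact j else 0)" for j
    by (simp add: coeff_laguerre A_def add_ac)
  have cS: "coeff (laguerre (Suc k) a) j = (if j \<le> Suc k then (-1) ^ j * (A gchoose (Suc k - j)) / fact j else 0)" for j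
    by (simp add: coeff_laguerre A_def add_ac)
  have rec: "real (Suc r) * (A gchoose Suc r) = (A - real r) * (A gchoose r)" for r
    using gbinomial_mult_1[of A r] by (simp add: algebra_simps)
  show "coeff (smult (real (Suc k)) (laguerre (Suc k) a)) j =
      coeff ([:0, 1:] * pderiv (laguerre k (a + 1)) + [:a + 1, -1:] * laguerre k (a + 1)) j"
  proof (cases j)
    case 0
    then show ?thesis using rec[of k] by (simp add: cL cS A_def)
  next
    case (Suc i)
    consider "i < k" | "i = k" | "i > k" by linarith
    then show ?thesis
    proof cases
      case 1
      define r where "r = k - Suc i"
      have r: "k - i = Suc r" "k - Suc i = r" "real k = real i + 1 + real r" using 1 by (auto simp: r_def)
      define F where "F = (-1) ^ i / (fact i :: real)"
      have i1: "(-1) ^ Suc i * g / fact (Suc i) = - F * g / real (Suc i)" for g :: real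
        by (simp add: F_def field_simps)
      have i0: "(-1) ^ i * g / fact i = F * g" for g :: real by (simp add: F_def)
      define G H where "G = (A gchoose Suc r)" and "H = (A gchoose r)"
      have "(A - real r) * H = real (Suc r) * G" using rec[of r] by (simp add: G_def H_def)
      then have "(real i + a + 2) * H = (real r + 1) * G" by (simp add: A_def r algebra_simps)
      then have "real (Suc k) * (- F * G / real (Suc i)) =
          (real (Suc i) + a + 1) * (- F * H / real (Suc i)) - F * G"
        by (simp add: r field_simps)
      moreover have "coeff (laguerre (Suc k) a) (Suc i) = - F * G / real (Suc i)"
        "coeff (laguerre k (a + 1)) (Suc i) = - F * H / real (Suc i)"
        "coeff (laguerre k (a + 1)) i = F * G"
        using 1 r by (simp_all add: cL cS i1 i0 G_def H_def del: power_Suc fact_Suc)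
      moreover have "coeff ([:0, 1:] * pderiv (laguerre k (a + 1)) + [:a + 1, -1:] * laguerre k (a + 1)) (Suc i)
          = (real (Suc i) + a + 1) * coeff (laguerre k (a + 1)) (Suc i) - coeff (laguerre k (a + 1)) i"
        by (simp add: coeff_pderiv algebra_simps)
      ultimately show ?thesis using Suc by (simp del: of_nat_Suc)
    next
      case 2
      then show ?thesis using Suc by (simp add: cL cS coeff_pderiv)
    next
      case 3
      then show ?thesis using Suc by (simp add: cL cS coeff_pderiv)
    qed
  qed
qed

lemma poly_laguerre_S_Suc:
  "real (Suc k) * poly (laguerre_S (Suc k) \<alpha>) x =
     x * poly (pderiv (laguerre_S k (\<alpha> + 1))) x + (\<alpha> + x) * poly (laguerre_S k (\<alpha> + 1)) x"
  using arg_cong[OF laguerre_Suc[of k "\<alpha> - 1"], of "\<lambda>p. poly p (- x)"]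
  by (simp add: laguerre_S_def poly_pcompose pderiv_pcompose pderiv_pCons algebra_simps)

text \<open>Induction on the degree with the parameter raised by one. At a zero \<open>s i\<close>
  of \<open>T\<close> the relation \<open>rec\<close> leaves only \<open>s i * T'(s i)\<close>,
  whose sign alternates in \<open>i\<close>; with the signs at 0 and far to the left this makes
  \<open>Suc m\<close> sign changes, hence all zeros.\<close>

lemma laguerre_S_zeros:
  assumes "\<alpha> > 0"
  shows "\<exists>s. (\<forall>i<m. s i < 0) \<and> (\<forall>i j. i < j \<longrightarrow> j < m \<longrightarrow> s j < s i) \<and>
           laguerre_S m \<alpha> = smult (1 / fact m) (\<Prod>i<m. [:- s i, 1:])"
  using assms
proof (induction m arbitrary: \<alpha>)
  case 0
  have "laguerre_S 0 \<alpha> = 1" by (simp add: laguerre_S_def laguerre_def pcompose_1)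
  then show ?case by simp
next
  case (Suc m)
  define T where "T = laguerre_S m (\<alpha> + 1)"
  define S where "S = laguerre_S (Suc m) \<alpha>"
  have "\<alpha> + 1 > 0" using Suc.prems by simp
  then obtain s where s: "\<And>i. i < m \<Longrightarrow> s i < 0" "\<And>i j. i < j \<Longrightarrow> j < m \<Longrightarrow> s j < s i"
    and T: "T = smult (1 / fact m) (\<Prod>i<m. [:- s i, 1:])"
    using Suc.IH[of "\<alpha> + 1"] unfolding T_def by blast
  have rec: "real (Suc m) * poly S x = x * poly (pderiv T) x + (\<alpha> + x) * poly T x" for x
    unfolding S_def T_def by (rule poly_laguerre_S_Suc)
  have dS: "degree S = Suc m" "lead_coeff S = 1 / fact (Suc m)"
    using laguerre_S_degree laguerre_S_lead_coeff by (auto simp: S_def)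
  have "poly T 0 > 0" using s by (auto simp: T poly_prod intro!: prod_pos divide_pos_pos)
  then have "real (Suc m) * poly S 0 > 0" using rec[of 0] Suc.prems by simp
  then have S0: "poly S 0 > 0" by (simp add: zero_less_mult_iff)
  have Ss: "(-1) ^ Suc i * poly S (s i) > 0" if "i < m" for i
  proof -
    have "poly T (s i) = 0" using that by (auto simp: T poly_prod)
    then have "real (Suc m) * poly S (s i) =
        s i / fact m * poly (pderiv (\<Prod>j<m. [:- s j, 1:])) (s i)"
      using rec[of "s i"] by (simp add: T pderiv_smult del: of_nat_Suc)
    then have "real (Suc m) * ((-1) ^ Suc i * poly S (s i)) =
        (- s i / fact m) * ((-1) ^ i * poly (pderiv (\<Prod>j<m. [:- s j, 1:])) (s i))"
      by (simp add: mult.left_commute[of "real (Suc m)"] del: of_nat_Suc)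
    also have "\<dots> > 0"
      using s(1)[OF that] sign_pderiv_prod_linear[of m s i, OF s(2) that]
      by (intro mult_pos_pos[of "- s i / fact m"]) (auto simp: divide_neg_pos)
    finally show ?thesis by (rule zero_less_mult_pos) simp
  qed
  \<comment> \<open>Inserting 0 keeps \<open>Min\<close> meaningful for \<open>m = 0\<close> and
    places \<open>e\<close> to the left of 0.\<close>
  define b where "b = Min (insert 0 (s ` {..<m}))"
  have b: "b \<le> 0" "\<And>i. i < m \<Longrightarrow> b \<le> s i" by (auto simp: b_def)
  obtain e where e: "e < b" "poly (smult ((-1) ^ Suc m) S) e > 0"
    using poly_pos_far_left[of "smult ((-1) ^ Suc m) S" b] dS
    by (auto simp del: power_Suc simp flip: power_mult_distrib)
  \<comment> \<open>Sample points from right to left: 0, the zeros of \<open>T\<close>, then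
    \<open>e\<close>. The leading 0 causes the index shift \<open>i - 1\<close>.\<close>
  define r where "r i = (if i = 0 then 0 else if i \<le> m then s (i - 1) else e)" for i
  have "r j < r i" if "i < j" "j \<le> Suc m" for i j
  proof -
    have "e < 0" "i \<le> m" "i > 0 \<Longrightarrow> e < s (i - 1)" using e b that by (force intro: less_le_trans)+
    then show ?thesis using s(1)[of "j - 1"] s(2)[of "i - 1" "j - 1"] that by (auto simp: r_def)
  qed
  moreover have "(-1) ^ i * poly S (r i) > 0" if "i \<le> Suc m" for i
    using S0 Ss[of "i - 1"] e that by (cases "i = 0"; cases "i \<le> m") (auto simp: r_def le_Suc_eq)
  ultimately obtain z where z: "\<And>i. i < Suc m \<Longrightarrow> r (Suc i) < z i \<and> z i < r i \<and> poly S (z i) = 0"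
      "\<And>i j. i < j \<Longrightarrow> j < Suc m \<Longrightarrow> z j < z i"
    using poly_zeros_between_sign_changes[of "Suc m" r S] by blast
  have "z i < 0" if "i < Suc m" for i
    using z(1)[of 0] z(2)[of 0 i] that by (cases "i = 0") (auto simp: r_def)
  moreover have "inj_on z {..<Suc m}"
    using z(2) by (intro linorder_inj_onI) force+
  then have "S = smult (lead_coeff S) (\<Prod>i<Suc m. [:- z i, 1:])"
    using z(1) dS by (intro poly_eq_smult_prod_roots) auto
  ultimately show ?case using z(2) dS(2) unfolding S_def[symmetric] by (intro exI[of _ z]) auto
qed

lemma laguerre_S_pos:
  assumes "\<alpha> > 0" "x \<ge> 0"
  shows "poly (laguerre_S m \<alpha>) x > 0"
proof -
  obtain s where "\<And>i. i < m \<Longrightarrow> s i < 0" "laguerre_S m \<alpha> = smult (1 / fact m) (\<Prod>i<m. [:- s i, 1:])"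
    using laguerre_S_zeros[OF assms(1), of m] by blast
  with assms(2) show ?thesis by (force simp: poly_prod intro!: prod_pos divide_pos_pos)
qed

text \<open>The explicit form \<open>(S + S') N - S N'\<close> takes the value \<open>S' N\<close> at the zeros of \<open>S\<close>, and \<open>N > 0\<close> there.\<close>

lemma exceptional_laguerre_I_negative_zeros:
  assumes "\<alpha> > 0" and s: "\<And>i. i < m \<Longrightarrow> s i < 0" "\<And>i j. i < j \<Longrightarrow> j < m \<Longrightarrow> s j < s i"
    and S: "laguerre_S m \<alpha> = smult (1 / fact m) (\<Prod>i<m. [:- s i, 1:])"
  shows "\<exists>z. (\<forall>i<m. z i < s i \<and> poly (exceptional_laguerre_I m n \<alpha>) (z i) = 0) \<and>
             (\<forall>i. Suc i < m \<longrightarrow> s (Suc i) < z i) \<and> (\<forall>i j. i < j \<longrightarrow> j < m \<longrightarrow> z j < z i)"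
proof -
  define y where "y = exceptional_laguerre_I m n \<alpha>"
  define N where "N = laguerre n (\<alpha> - 1)"
  have y: "y = (laguerre_S m \<alpha> + pderiv (laguerre_S m \<alpha>)) * N - laguerre_S m \<alpha> * pderiv N"
    unfolding y_def N_def
    using exceptional_laguerre_I is_exceptional_laguerre_I_explicit is_exceptional_laguerre_I_unique by blast
  have dy: "degree y = m + n" "lead_coeff y = (-1) ^ n / (fact m * fact n)"
    using exceptional_laguerre_I[of m n \<alpha>] by (auto simp: is_exceptional_laguerre_I_def y_def)
  have sign: "(-1) ^ i * poly y (s i) > 0" if "i < m" for i
  proof -
    have "poly (laguerre_S m \<alpha>) (s i) = 0" using that by (auto simp: S poly_prod)
    then have "poly y (s i) = poly (pderiv (laguerre_S m \<alpha>)) (s i) * poly N (s i)" by (simp add: y)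
    then have "(-1) ^ i * poly y (s i) =
        ((-1) ^ i * poly (pderiv (\<Prod>i<m. [:- s i, 1:])) (s i)) * (poly N (s i) / fact m)"
      by (simp add: S pderiv_smult)
    \<comment> \<open>\<open>N\<close> is the reflection of \<open>laguerre_S n \<alpha>\<close>, so
      its value at the negative \<open>s i\<close> is a value of the latter on the positive
      axis.\<close>
    moreover have "poly N (s i) > 0"
      using laguerre_S_pos[OF assms(1), of "- s i" n] s(1)[OF that]
      by (simp add: N_def laguerre_S_def poly_pcompose)
    ultimately show ?thesis
      using sign_pderiv_prod_linear[of m s i] s(2) that by simp
  qed
  define b where "b = Min (insert 0 (s ` {..<m}))"
  have b: "\<And>i. i < m \<Longrightarrow> b \<le> s i" by (auto simp: b_def)
  have "(-1) ^ degree (smult ((-1) ^ m) y) * lead_coeff (smult ((-1) ^ m) y) = 1 / (fact m * fact n)"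
    using dy by (cases "even m"; cases "even n") (auto simp: power_add)
  then obtain e where e: "e < b" "(-1) ^ m * poly y e > 0"
    using poly_pos_far_left[of "smult ((-1) ^ m) y" b] by auto
  \<comment> \<open>The zeros of \<open>S\<close> supply \<open>m\<close> sample points;
    \<open>e\<close> adds a last gap, so that the smallest of them also has a zero to its
    left.\<close>
  define r where "r i = (if i < m then s i else e)" for i
  have "r j < r i" if "i < j" "j \<le> m" for i j
    using s(2)[of i j] b[of i] e that by (auto simp: r_def)
  moreover have "(-1) ^ i * poly y (r i) > 0" if "i \<le> m" for i
    using sign[of i] e that by (auto simp: r_def)
  ultimately obtain z where z: "\<And>i. i < m \<Longrightarrow> r (Suc i) < z i \<and> z i < r i \<and> poly y (z i) = 0"
      "\<And>i j. i < j \<Longrightarrow> j < m \<Longrightarrow> z j < z i"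
    using poly_zeros_between_sign_changes[of m r y] by blast
  have "s (Suc i) < z i" if "Suc i < m" for i using z(1)[of i] that by (simp add: r_def)
  moreover have "z i < s i" "poly y (z i) = 0" if "i < m" for i using z(1)[of i] that by (auto simp: r_def)
  ultimately show ?thesis using z(2) unfolding y_def by (intro exI[of _ z]) auto
qed

subsection \<open>Stability and minimality of the Gruenwald operator\<close>

text \<open>This function is the reciprocal weight, the product being \<open>S / P\<close>:
  numerator and denominator have the same leading coefficient.\<close>

lemma (in exp_dominated_functional) dominated_weight_reciprocal:
  assumes "\<alpha> > 1" and s: "\<And>i. i < m \<Longrightarrow> s i < 0" and z: "\<And>i. i < m \<Longrightarrow> z i < 0"
    and interlace: "\<And>i. Suc i < m \<Longrightarrow> s (Suc i) < z i"
  shows "dominated (\<lambda>x. exp x * x powr (- (\<alpha> + 1)) * (\<Prod>i<m. (x - s i) / (x - z i))\<^sup>2)"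
proof -
  \<comment> \<open>\<open>a\<close> enumerates the zeros of \<open>x * P\<close> from the right: 0
    first, then the \<open>z j\<close>. The shift puts \<open>s i\<close> below its partner
    \<open>a i\<close>; in the application it lies above \<open>z i\<close>.\<close>
  define a where "a i = (case i of 0 \<Rightarrow> 0 | Suc j \<Rightarrow> z j)" for i
  have a: "a i \<le> 0" if "i \<le> m" for i
    using z that by (auto simp: a_def split: nat.splits intro: less_imp_le)
  have sa: "s i \<le> a i" if "i < m" for i
    using s[OF that] interlace that by (auto simp: a_def split: nat.splits intro: less_imp_le)
  \<comment> \<open>\<open>R\<close> is \<open>S / (x * P)\<close>; the unpaired zero
    \<open>a m\<close> leaves the single factor \<open>1 / (x - a m)\<close>.\<close>
  define R where "R x = (\<Prod>i<m. (x - s i) / (x - a i)) / (x - a m)" for x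
  have mult_R: "dominated (\<lambda>x. R x * f x)" if "dominated f" for f
    using dominated_prod_quotient[OF dominated_divide[OF that a[OF order_refl]], of "{..<m}" s a] a sa
    by (simp add: R_def)
  \<comment> \<open>The two factors \<open>R\<close> absorb \<open>x powr (- 2)\<close>; the
    remaining exponent \<open>\<alpha> - 1\<close> is positive because
    \<open>\<alpha> > 1\<close>.\<close>
  have "dominated (\<lambda>x. R x * (R x * (exp (1 * x) * ((x - 0) powr (- (\<alpha> - 1)) * 1))))"
    by (intro mult_R dominated_exp dominated_powr dominated_1) (use \<open>\<alpha> > 1\<close> in auto)
  then show ?thesis
  proof (rule dominated_cong)
    fix x :: real assume "x > 0"
    \<comment> \<open>The product of \<open>x - a i\<close> over \<open>i \<le> m\<close>, with the
      last and with the first factor split off.\<close>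
    have "(\<Prod>i<m. x - a i) * (x - a m) = x * (\<Prod>i<m. x - z i)"
      using prod.lessThan_Suc[of "\<lambda>i. x - a i" m] prod.lessThan_Suc_shift[of "\<lambda>i. x - a i" m]
      by (simp add: a_def)
    then have R: "R x = (\<Prod>i<m. (x - s i) / (x - z i)) / x"
      by (simp add: R_def prod_dividef mult.commute)
    have "x powr (- (\<alpha> - 1)) = x powr (- (\<alpha> + 1)) * x\<^sup>2"
      using \<open>x > 0\<close> by (simp add: powr_add[symmetric] flip: powr_numeral)
    then show "R x * (R x * (exp (1 * x) * ((x - 0) powr (- (\<alpha> - 1)) * 1))) =
        exp x * x powr (- (\<alpha> + 1)) * (\<Prod>i<m. (x - s i) / (x - z i))\<^sup>2"
      using \<open>x > 0\<close> unfolding R by (simp add: power2_eq_square)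
  qed
qed

section \<open>Lagrange basis and Hermite functional at the nodes\<close>

lemma poly_pderiv_node_poly:
  assumes "k \<in> {1..n}"
  shows "poly (pderiv (node_poly n x)) (x k) = (\<Prod>j\<in>{1..n} - {k}. x k - x j)"
  unfolding node_poly_def using assms by (intro poly_pderiv_prod_linear) auto

lemma poly_pderiv_node_poly_nonzero:
  assumes "inj_on x {1..n}" "k \<in> {1..n}"
  shows "poly (pderiv (node_poly n x)) (x k) \<noteq> 0"
  using assms unfolding poly_pderiv_node_poly[OF assms(2)] by (auto dest: inj_onD)

lemma lagrange_basis_eq:
  assumes "k \<in> {1..n}"
  shows "lagrange_basis n x k =
    smult (1 / poly (pderiv (node_poly n x)) (x k)) (\<Prod>j\<in>{1..n} - {k}. [:- x j, 1:])"
proof -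
  have "node_poly n x = [:- x k, 1:] * (\<Prod>j\<in>{1..n} - {k}. [:- x j, 1:])"
    unfolding node_poly_def using assms by (intro prod.remove) auto
  then have "node_poly n x div [:- x k, 1:] = (\<Prod>j\<in>{1..n} - {k}. [:- x j, 1:])"
    by (metis nonzero_mult_div_cancel_left pCons_eq_0_iff one_neq_zero)
  then show ?thesis by (simp add: lagrange_basis_def)
qed

lemma poly_lagrange_basis_node:
  assumes "inj_on x {1..n}" "k \<in> {1..n}" "i \<in> {1..n}"
  shows "poly (lagrange_basis n x k) (x i) = (if k = i then 1 else 0)"
proof (cases "k = i")
  case True
  have "poly (\<Prod>j\<in>{1..n} - {k}. [:- x j, 1:]) (x k) = poly (pderiv (node_poly n x)) (x k)"
    unfolding poly_pderiv_node_poly[OF assms(2)] poly_prod by simp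
  then show ?thesis
    using poly_pderiv_node_poly_nonzero[OF assms(1,2)] True[symmetric]
    unfolding lagrange_basis_eq[OF assms(2)] by simp
next
  case False
  then show ?thesis using assms by (auto simp: lagrange_basis_eq poly_prod)
qed

lemma degree_lagrange_basis:
  assumes "inj_on x {1..n}" "k \<in> {1..n}"
  shows "degree (lagrange_basis n x k) = n - 1"
  using assms poly_pderiv_node_poly_nonzero[OF assms]
  by (simp add: lagrange_basis_eq degree_prod_linear)

text \<open>Write the node polynomial as \<open>q = (x - x k) * R\<close>. At \<open>x k\<close> one
  has \<open>q' = R\<close> and \<open>q'' = 2 * R'\<close>, and the basis polynomial is
  \<open>R\<close> divided by \<open>q'(x k)\<close>.\<close>

lemma poly_pderiv_lagrange_basis:
  assumes "k \<in> {1..n}"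
  shows "2 * poly (pderiv (lagrange_basis n x k)) (x k) =
    poly (pderiv (pderiv (node_poly n x))) (x k) / poly (pderiv (node_poly n x)) (x k)"
proof -
  define R where "R = (\<Prod>j\<in>{1..n} - {k}. [:- x j, 1:])"
  have "node_poly n x = [:- x k, 1:] * R"
    unfolding node_poly_def R_def using assms by (intro prod.remove) auto
  then have "pderiv (node_poly n x) = R + [:- x k, 1:] * pderiv R"
    by (simp only: pderiv_mult) (simp add: pderiv_pCons)
  then have "poly (pderiv (pderiv (node_poly n x))) (x k) = 2 * poly (pderiv R) (x k)"
    by (simp only: pderiv_add pderiv_mult) (simp add: pderiv_pCons)
  then show ?thesis
    unfolding lagrange_basis_eq[OF assms] R_def[symmetric] by (simp add: pderiv_smult)
qed

text \<open>The two coefficients at node \<open>k\<close> are the Hermite basis polynomials for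
  value and slope, taken at \<open>t\<close>. The locale assumption thus compares
  \<open>exp (c * x)\<close> with its Hermite interpolant.\<close>

lemma hermite_functional:
  assumes "n \<ge> 1" and inj: "inj_on x {1..n}" and pos: "\<And>k. k \<in> {1..n} \<Longrightarrow> x k > 0" and "t > 0"
  defines "l \<equiv> lagrange_basis n x"
  defines "d \<equiv> \<lambda>k. 2 * poly (pderiv (l k)) (x k)"
  shows "exp_dominated_functional {1..n} x
    (\<lambda>k. (poly (l k) t)\<^sup>2 * (1 - d k * (t - x k))) (\<lambda>k. (poly (l k) t)\<^sup>2 * (t - x k)) t"
proof
  fix c
  define e where "e k = exp (c * x k)" for k
  \<comment> \<open>The linear factor with value \<open>e k\<close> and slope
    \<open>(c - d k) * e k\<close> at \<open>x k\<close>; as the square of \<open>l k\<close> has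
    slope \<open>d k\<close> there, the product gets slope \<open>c * e k\<close>.\<close>
  define h where "h k = [:e k - (c - d k) * e k * x k, (c - d k) * e k:]" for k
  define p where "p = (\<Sum>k\<in>{1..n}. (l k)\<^sup>2 * h k)"
  have node: "poly (l k) (x i) = (if k = i then 1 else 0)" if "k \<in> {1..n}" "i \<in> {1..n}" for k i
    unfolding l_def using inj that by (rule poly_lagrange_basis_node)
  have "poly p t \<le> exp (c * t)"
  proof (rule hermite_interpolant_le_exp[where X = "x ` {1..n}"])
    show "finite (x ` {1..n})" "x ` {1..n} \<noteq> {}" using \<open>n \<ge> 1\<close> by auto
    have "degree p \<le> 2 * (n - 1) + 1"
      unfolding p_def
    proof (rule degree_sum_le)
      fix k assume k: "k \<in> {1..n}"
      have "degree ((l k)\<^sup>2) \<le> 2 * (n - 1)"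
        using degree_power_le[of "l k" 2] degree_lagrange_basis[OF inj k] by (simp add: l_def mult.commute)
      moreover have "degree (h k) \<le> 1" by (simp add: h_def)
      ultimately show "degree ((l k)\<^sup>2 * h k) \<le> 2 * (n - 1) + 1"
        using degree_mult_le[of "(l k)\<^sup>2" "h k"] by linarith
    qed simp
    then show "degree p < 2 * card (x ` {1..n})" using \<open>n \<ge> 1\<close> inj by (simp add: card_image)
  next
    fix a assume "a \<in> x ` {1..n}"
    then obtain i where i: "i \<in> {1..n}" "a = x i" by blast
    have "poly p a = (\<Sum>k\<in>{1..n}. if k = i then e i else 0)"
      unfolding p_def poly_sum i(2) using node i(1)
      by (intro sum.cong) (auto simp: h_def algebra_simps)
    then show "poly p a = exp (c * a)" using i by (simp add: e_def)
    have h: "poly (h k) (x k) = e k" "pderiv (h k) = [:(c - d k) * e k:]" for k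
      by (simp_all add: h_def pderiv_pCons algebra_simps)
    have "poly (pderiv p) a = (\<Sum>k\<in>{1..n}. if k = i then c * e i else 0)"
      unfolding p_def higher_pderiv_sum[of 1, simplified] poly_sum i(2) using node i(1)
      by (intro sum.cong) (auto simp: h pderiv_mult power2_eq_square d_def algebra_simps)
    then show "poly (pderiv p) a = c * exp (c * a)" using i by (simp add: e_def)
  qed
  also have "poly p t = (\<Sum>k\<in>{1..n}. exp (c * x k) *
      ((poly (l k) t)\<^sup>2 * (1 - d k * (t - x k)) + (poly (l k) t)\<^sup>2 * (t - x k) * c))"
    unfolding p_def poly_sum by (intro sum.cong) (auto simp: h_def e_def algebra_simps)
  finally show "(\<Sum>k\<in>{1..n}. exp (c * x k) *
      ((poly (l k) t)\<^sup>2 * (1 - d k * (t - x k)) + (poly (l k) t)\<^sup>2 * (t - x k) * c)) \<le> exp (c * t)" .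
qed (use pos \<open>t > 0\<close> in auto)

text \<open>A nonzero polynomial that is nonnegative on the half-line has order at least 2 wherever
  it vanishes there; adding the orders at the other \<open>n - 1\<close> nodes bounds the
  degree.\<close>

lemma degree_stable_system_ge:
  assumes stable: "stable_system w {0<..} n x l" and inj: "inj_on x {1..n}"
    and pos: "\<And>k. k \<in> {1..n} \<Longrightarrow> x k > 0" and w: "\<And>t. t > 0 \<Longrightarrow> w t > 0" and k: "k \<in> {1..n}"
  shows "2 * (n - 1) \<le> degree (l k)"
proof -
  have node: "poly (l k) (x i) = (if k = i then 1 else 0)" if "i \<in> {1..n}" for i
    using stable k that by (auto simp: stable_system_def interpolatory_system_def)
  have nonneg: "poly (l k) t \<ge> 0" if "t > 0" for t
  proof -
    \<comment> \<open>Unit data at \<open>k\<close> isolate \<open>l k\<close> in the sum.\<close>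
    have "0 \<le> w t * (\<Sum>j=1..n. poly (l j) t / w (x j) * (if j = k then 1 else 0))"
      using stable that unfolding stable_system_def by fastforce
    also have "\<dots> = w t / w (x k) * poly (l k) t"
      using k by (simp add: if_distrib[of "\<lambda>u. _ * u"] sum.delta cong: if_cong)
    finally show ?thesis using w[OF that] w[OF pos[OF k]] by (simp add: zero_le_mult_iff zero_le_divide_iff)
  qed
  have nz: "l k \<noteq> 0" using node[OF k] by auto
  have ord: "2 \<le> order (x i) (l k)" if "i \<in> {1..n} - {k}" for i
  proof -
    have root: "poly (l k) (x i) = 0" using node that by auto
    \<comment> \<open>The zero is a local minimum; the radius \<open>x i\<close> keeps the
      neighbourhood inside the half-line.\<close>
    have "poly (pderiv (l k)) (x i) = 0"
    proof (rule DERIV_local_min)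
      show "(poly (l k) has_real_derivative poly (pderiv (l k)) (x i)) (at (x i))" by (rule poly_DERIV)
      show "x i > 0" using pos that by auto
      show "\<forall>t. \<bar>x i - t\<bar> < x i \<longrightarrow> poly (l k) (x i) \<le> poly (l k) t" using nonneg root by auto
    qed
    moreover obtain r where r: "l k = [:- x i, 1:] * r" using root by (auto simp: poly_eq_0_iff_dvd)
    ultimately have "poly r (x i) = 0"
      by (simp only: pderiv_mult) (simp add: pderiv_pCons)
    then have "[:- x i, 1:] dvd r" by (simp add: poly_eq_0_iff_dvd)
    then have "[:- x i, 1:] ^ 2 dvd l k" unfolding r power2_eq_square by (rule mult_dvd_mono[OF dvd_refl])
    then show ?thesis using nz by (simp add: order_divides)
  qed
  have "2 * (n - 1) = (\<Sum>a\<in>x ` ({1..n} - {k}). 2)"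
    using k inj by (simp add: card_image inj_on_diff)
  also have "\<dots> \<le> (\<Sum>a\<in>x ` ({1..n} - {k}). order a (l k))"
    by (intro sum_mono) (use ord in blast)
  also have "\<dots> \<le> (\<Sum>a | poly (l k) a = 0. order a (l k))"
    using poly_roots_finite[OF nz] node by (intro sum_mono2) auto
  also have "\<dots> \<le> degree (l k)" using nz by (rule sum_order_le_degree)
  finally show ?thesis .
qed

section \<open>Differential equation and reciprocal weight at the nodes\<close>

text \<open>At a zero of \<open>q\<close> the term of order zero drops out,
  \<open>y' = c * P * q'\<close> and \<open>y'' = c * (2 * P' * q' + P * q'')\<close>. Division by
  \<open>c * P * q'\<close> leaves the logarithmic derivative of the reciprocal weight.\<close>

lemma exceptional_laguerre_I_ode_at_zero:
  assumes y: "exceptional_laguerre_I m n \<alpha> = smult c (P * q)" "c \<noteq> 0"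
    and "poly q a = 0" "poly (pderiv q) a \<noteq> 0" "poly P a \<noteq> 0" "a \<noteq> 0" "poly (laguerre_S m \<alpha>) a \<noteq> 0"
  shows "poly (pderiv (pderiv q)) a / poly (pderiv q) a =
    1 - (\<alpha> + 1) / a + 2 * poly (pderiv (laguerre_S m \<alpha>)) a / poly (laguerre_S m \<alpha>) a
      - 2 * poly (pderiv P) a / poly P a"
proof -
  define S where "S = laguerre_S m \<alpha>"
  have y0: "poly (smult c (P * q)) a = 0" using assms(3) by simp
  have y1: "poly (pderiv (smult c (P * q))) a = c * poly P a * poly (pderiv q) a"
    using assms(3) by (simp add: pderiv_smult pderiv_mult)
  have y2: "poly (pderiv (pderiv (smult c (P * q)))) a =
      c * (2 * poly (pderiv P) a * poly (pderiv q) a + poly P a * poly (pderiv (pderiv q)) a)"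
    using assms(3) by (simp add: pderiv_smult pderiv_mult pderiv_add algebra_simps)
  have "poly (pderiv (pderiv (smult c (P * q)))) a +
      ((\<alpha> + 1 - a) / a - 2 * poly (pderiv S) a / poly S a) * poly (pderiv (smult c (P * q))) a = 0"
    using exceptional_laguerre_I[of m n \<alpha>] assms(6,7) y0
    unfolding is_exceptional_laguerre_I_def y(1) S_def by auto
  then have "c * (2 * poly (pderiv P) a * poly (pderiv q) a + poly P a * poly (pderiv (pderiv q)) a +
      ((\<alpha> + 1 - a) / a - 2 * poly (pderiv S) a / poly S a) * poly P a * poly (pderiv q) a) = 0"
    unfolding y1 y2 by (simp add: algebra_simps)
  then have "2 * poly (pderiv P) a * poly (pderiv q) a + poly P a * poly (pderiv (pderiv q)) a +
      ((\<alpha> + 1 - a) / a - 2 * poly (pderiv S) a / poly S a) * poly P a * poly (pderiv q) a = 0"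
    using assms(2) by simp
  then have "poly P a * poly (pderiv (pderiv q)) a = poly P a * poly (pderiv q) a *
      (1 - (\<alpha> + 1) / a + 2 * poly (pderiv S) a / poly S a - 2 * poly (pderiv P) a / poly P a)"
    using assms(5,6) by (simp add: diff_divide_distrib algebra_simps)
  then have "poly (pderiv (pderiv q)) a = poly (pderiv q) a *
      (1 - (\<alpha> + 1) / a + 2 * poly (pderiv S) a / poly S a - 2 * poly (pderiv P) a / poly P a)"
    using assms(5) by (simp only: mult.assoc mult_cancel_left simp_thms)
  then show ?thesis using assms(4) by (simp add: S_def)
qed

text \<open>Logarithmic differentiation. The factor is the right-hand side of
  \<open>exceptional_laguerre_I_ode_at_zero\<close>, so \<open>g' / g\<close> equals
  \<open>q'' / q'\<close> at the nodes.\<close>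

lemma weight_reciprocal_deriv:
  fixes P S :: "real poly" and a \<alpha> :: real
  assumes "a > 0" "poly P a \<noteq> 0" "poly S a \<noteq> 0"
  defines "g \<equiv> \<lambda>x. exp x * x powr (- (\<alpha> + 1)) * (poly S x / poly P x)\<^sup>2"
  shows "(g has_real_derivative (1 - (\<alpha> + 1) / a + 2 * poly (pderiv S) a / poly S a
      - 2 * poly (pderiv P) a / poly P a) * g a) (at a)"
proof -
  have deriv: "((\<lambda>x. exp x * x powr (- (\<alpha> + 1)) * (poly S x / poly P x)\<^sup>2) has_real_derivative
     exp a * a powr (- (\<alpha> + 1)) * (poly S a / poly P a)\<^sup>2
     + exp a * (- (\<alpha> + 1) * a powr (- (\<alpha> + 1) - 1)) * (poly S a / poly P a)\<^sup>2
     + exp a * a powr (- (\<alpha> + 1)) * (2 * (poly S a / poly P a) *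
        ((poly (pderiv S) a * poly P a - poly S a * poly (pderiv P) a) / (poly P a * poly P a)))) (at a)"
    using assms by (auto intro!: derivative_eq_intros simp: algebra_simps)
  define E where "E = a powr (- (\<alpha> + 1))"
  have E: "a powr (- (\<alpha> + 1) - 1) = E / a"
    unfolding E_def using assms(1) by (subst powr_diff) simp
  show ?thesis
    unfolding g_def
    by (rule DERIV_cong[OF deriv], unfold E E_def[symmetric])
      (use assms(1-3) in \<open>simp add: field_simps power2_eq_square\<close>)
qed

text \<open>Since \<open>g' = d k * g\<close> at \<open>x k\<close>, the terms with
  \<open>t - x k\<close> in the Hermite interpolant of \<open>g\<close> cancel, and only the squares
  remain.\<close>

lemma sum_lagrange_basis_sq_le:
  fixes g :: "real \<Rightarrow> real"
  assumes "n \<ge> 1" and inj: "inj_on x {1..n}" and pos: "\<And>k. k \<in> {1..n} \<Longrightarrow> x k > 0" and "t > 0"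
    and "\<alpha> > 1" and P: "P = smult c (\<Prod>i<m. [:- z i, 1:])" and S: "S = smult c (\<Prod>i<m. [:- s i, 1:])"
    and "c \<noteq> 0" and s: "\<And>i. i < m \<Longrightarrow> s i < 0" and z: "\<And>i. i < m \<Longrightarrow> z i < 0"
    and interlace: "\<And>i. Suc i < m \<Longrightarrow> s (Suc i) < z i"
    and ode: "\<And>k. k \<in> {1..n} \<Longrightarrow>
      poly (pderiv (pderiv (node_poly n x))) (x k) / poly (pderiv (node_poly n x)) (x k) =
      1 - (\<alpha> + 1) / x k + 2 * poly (pderiv S) (x k) / poly S (x k) - 2 * poly (pderiv P) (x k) / poly P (x k)"
  defines "g \<equiv> \<lambda>x. exp x * x powr (- (\<alpha> + 1)) * (poly S x / poly P x)\<^sup>2"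
  shows "(\<Sum>k=1..n. (poly (lagrange_basis n x k) t)\<^sup>2 * g (x k)) \<le> g t"
proof -
  define l where "l = lagrange_basis n x"
  define d where "d k = 2 * poly (pderiv (l k)) (x k)" for k
  interpret H: exp_dominated_functional "{1..n}" x
    "\<lambda>k. (poly (l k) t)\<^sup>2 * (1 - d k * (t - x k))" "\<lambda>k. (poly (l k) t)\<^sup>2 * (t - x k)" t
    unfolding l_def d_def using assms(1-4) by (rule hermite_functional)
  have SP: "poly S u / poly P u = (\<Prod>i<m. (u - s i) / (u - z i))" for u
    using \<open>c \<noteq> 0\<close> by (simp add: S P poly_prod prod_dividef)
  have "H.dominated g"
    unfolding g_def SP using \<open>\<alpha> > 1\<close> s z interlace by (rule H.dominated_weight_reciprocal)
  moreover have "(g has_real_derivative d k * g (x k)) (at (x k))" if k: "k \<in> {1..n}" for k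
  proof -
    have "poly S (x k) \<noteq> 0" "poly P (x k) \<noteq> 0"
      using s z pos[OF k] \<open>c \<noteq> 0\<close> by (force simp: S P poly_prod)+
    then show ?thesis
      using weight_reciprocal_deriv[OF pos[OF k], of P S \<alpha>]
      unfolding g_def d_def l_def poly_pderiv_lagrange_basis[OF k] ode[OF k] by blast
  qed
  \<comment> \<open>The instance \<open>c = 0\<close> is the inequality for \<open>g\<close>
    itself.\<close>
  ultimately have "(\<Sum>k\<in>{1..n}. exp (0 * x k) * ((poly (l k) t)\<^sup>2 * (1 - d k * (t - x k)) * g (x k) +
      (poly (l k) t)\<^sup>2 * (t - x k) * (0 * g (x k) + d k * g (x k)))) \<le> exp (0 * t) * g t"
    by (rule H.dominated_D)
  then show ?thesis by (simp add: l_def algebra_simps)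
qed

text \<open>The squares are nonnegative, so constant data are the worst case and stability reduces
  to the single inequality \<open>le\<close>.\<close>

lemma grunwald_stable:
  assumes "n \<ge> 1" and inj: "inj_on x {1..n}" and "\<And>k. k \<in> {1..n} \<Longrightarrow> w (x k) > 0"
    and "\<And>t. t \<in> I \<Longrightarrow> w t > 0"
    and le: "\<And>t. t \<in> I \<Longrightarrow> (\<Sum>k=1..n. (poly (lagrange_basis n x k) t)\<^sup>2 / w (x k)) \<le> 1 / w t"
  shows "stable_system w I n x (grunwald_system n x)"
  unfolding stable_system_def interpolatory_system_def
proof (intro conjI allI impI ballI)
  fix k i assume "k \<in> {1..n}" "i \<in> {1..n}"
  then show "poly (grunwald_system n x k) (x i) = (if k = i then 1 else 0)"
    using poly_lagrange_basis_node[OF inj] by (simp add: grunwald_system_def)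
next
  fix y :: "nat \<Rightarrow> real" and t
  assume y: "\<forall>k\<in>{1..n}. 0 \<le> y k" and t: "t \<in> I"
  show "0 \<le> w t * (\<Sum>k=1..n. poly (grunwald_system n x k) t / w (x k) * y k)"
    using y assms(3) assms(4)[OF t]
    by (intro mult_nonneg_nonneg sum_nonneg) (auto simp: grunwald_system_def less_imp_le)
  define M where "M = Max (y ` {1..n})"
  have M: "y k \<le> M" if "k \<in> {1..n}" for k using that by (simp add: M_def)
  have "1 \<in> {1..n}" using \<open>n \<ge> 1\<close> by simp
  then have "0 \<le> M" using y M[of 1] by (blast intro: order_trans)
  have "(\<Sum>k=1..n. poly (grunwald_system n x k) t / w (x k) * y k) \<le>
      (\<Sum>k=1..n. (poly (lagrange_basis n x k) t)\<^sup>2 / w (x k) * M)"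
  proof (rule sum_mono)
    fix k assume k: "k \<in> {1..n}"
    show "poly (grunwald_system n x k) t / w (x k) * y k \<le> (poly (lagrange_basis n x k) t)\<^sup>2 / w (x k) * M"
      using mult_left_mono[OF M[OF k], of "(poly (lagrange_basis n x k) t)\<^sup>2 / w (x k)"] assms(3)[OF k]
      by (simp add: grunwald_system_def)
  qed
  also have "\<dots> \<le> 1 / w t * M"
    using mult_right_mono[OF le[OF t] \<open>0 \<le> M\<close>] by (simp add: sum_distrib_right)
  finally show "w t * (\<Sum>k=1..n. poly (grunwald_system n x k) t / w (x k) * y k) \<le> Max (y ` {1..n})"
    using assms(4)[OF t] unfolding M_def by (simp add: field_simps)
qed

theorem theorem3:
  fixes m n :: nat and \<alpha> :: real and x :: "nat \<Rightarrow> real"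
  assumes "m \<ge> 1" and "n \<ge> 1" and "\<alpha> > 1"
    and "strict_mono_on {1..n} x"
    and "x ` {1..n} = {t. t > 0 \<and> poly (exceptional_laguerre_I m n \<alpha>) t = 0}"
  shows "stable_system (exceptional_weight m n \<alpha>) {0<..} n x (grunwald_system n x)
    \<and> most_economical (exceptional_weight m n \<alpha>) {0<..} n x (grunwald_system n x)"
proof -
  define y S P q w where "y = exceptional_laguerre_I m n \<alpha>" and "S = laguerre_S m \<alpha>"
    and "P = exceptional_laguerre_P m n \<alpha>" and "q = node_poly n x" and "w = exceptional_weight m n \<alpha>"
  have "\<alpha> > 0" using \<open>\<alpha> > 1\<close> by simp
  have inj: "inj_on x {1..n}" using assms(4) by (rule strict_mono_on_imp_inj_on)
  have node: "x k > 0" "poly y (x k) = 0" if "k \<in> {1..n}" for k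
    using assms(5) that unfolding y_def by blast+
  have dy: "degree y = m + n" "lead_coeff y = (-1) ^ n / (fact m * fact n)"
    using exceptional_laguerre_I[of m n \<alpha>] by (auto simp: is_exceptional_laguerre_I_def y_def)
  obtain s where s: "\<And>i. i < m \<Longrightarrow> s i < 0" "\<And>i j. i < j \<Longrightarrow> j < m \<Longrightarrow> s j < s i"
    and S: "S = smult (1 / fact m) (\<Prod>i<m. [:- s i, 1:])"
    unfolding S_def using laguerre_S_zeros[OF \<open>\<alpha> > 0\<close>, of m] by blast
  obtain z where z: "\<And>i. i < m \<Longrightarrow> z i < s i" "\<And>i. i < m \<Longrightarrow> poly y (z i) = 0"
      "\<And>i. Suc i < m \<Longrightarrow> s (Suc i) < z i" "\<And>i j. i < j \<Longrightarrow> j < m \<Longrightarrow> z j < z i"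
    using exceptional_laguerre_I_negative_zeros[OF \<open>\<alpha> > 0\<close> s S[unfolded S_def], of n]
    unfolding y_def by blast
  have z_neg: "z i < 0" if "i < m" for i using z(1) s(1) that less_trans by blast
  have inj_z: "inj_on z {..<m}" using z(4) by (intro linorder_inj_onI) force+
  define Z where "Z = z ` {..<m}"
  have disj: "Z \<inter> x ` {1..n} = {}" using z_neg node(1) by (force simp: Z_def)
  \<comment> \<open>The \<open>m\<close> negative zeros found and the \<open>n\<close> nodes exhaust
    the degree, so all zeros are real and simple.\<close>
  have "card (Z \<union> x ` {1..n}) = degree y"
    using disj inj inj_z dy(1) by (simp add: Z_def card_Un_disjoint card_image)
  moreover have "poly y a = 0" if "a \<in> Z \<union> x ` {1..n}" for a
    using that z(2) node(2) unfolding Z_def by blast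
  ultimately have "y = smult (lead_coeff y) (\<Prod>a\<in>Z \<union> x ` {1..n}. [:- a, 1:])"
    by (intro poly_eq_smult_prod_roots) (auto simp: Z_def)
  also have "(\<Prod>a\<in>Z \<union> x ` {1..n}. [:- a, 1:]) = (\<Prod>a\<in>Z. [:- a, 1:]) * q"
    using disj inj by (simp add: Z_def prod.union_disjoint prod.reindex q_def node_poly_def)
  finally have y_eq: "y = smult (lead_coeff y) ((\<Prod>a\<in>Z. [:- a, 1:]) * q)" .
  have y_nz: "lead_coeff y \<noteq> 0" using dy(2) by simp
  \<comment> \<open>There are no further negative zeros, so the product in
    \<open>exceptional_laguerre_P\<close> runs over exactly the \<open>z i\<close>.\<close>
  have "{a. a < 0 \<and> poly y a = 0} = Z"
  proof (intro equalityI subsetI)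
    fix a assume "a \<in> {a. a < 0 \<and> poly y a = 0}"
    moreover have "poly q a \<noteq> 0" if "a < 0" using node(1) that by (force simp: q_def node_poly_def poly_prod)
    moreover have "poly y a = lead_coeff y * ((\<Prod>b\<in>Z. a - b) * poly q a)"
      by (subst y_eq) (simp add: poly_prod)
    ultimately show "a \<in> Z" using y_nz by (auto simp: Z_def)
  qed (use z z_neg in \<open>auto simp: Z_def\<close>)
  then have P: "P = smult (1 / fact m) (\<Prod>a\<in>Z. [:- a, 1:])"
    by (simp add: P_def exceptional_laguerre_P_def y_def)
  then have P_z: "P = smult (1 / fact m) (\<Prod>i<m. [:- z i, 1:])"
    using inj_z by (simp add: Z_def prod.reindex)
  \<comment> \<open>\<open>fact m\<close> compensates the leading coefficient
    \<open>1 / fact m\<close> of \<open>P\<close>.\<close>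
  have y_Pq: "exceptional_laguerre_I m n \<alpha> = smult (lead_coeff y * fact m) (P * q)"
    unfolding y_def[symmetric] by (subst y_eq) (simp add: P)
  have S_pos: "poly S t > 0" if "t > 0" for t
    using laguerre_S_pos[OF \<open>\<alpha> > 0\<close>] that by (simp add: S_def)
  have P_pos: "poly P t > 0" if "t > 0" for t
    using z_neg that by (force simp: P_z poly_prod intro!: prod_pos divide_pos_pos)
  have w_pos: "w t > 0" if "t > 0" for t
    using S_pos[OF that] P_pos[OF that] that
    by (simp add: w_def exceptional_weight_def S_def[symmetric] P_def[symmetric])
  have w_inv: "1 / w t = exp t * t powr (- (\<alpha> + 1)) * (poly S t / poly P t)\<^sup>2" for t
    unfolding powr_minus
    by (simp add: w_def exceptional_weight_def S_def[symmetric] P_def[symmetric] exp_minus field_simps)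
  have ode: "poly (pderiv (pderiv (node_poly n x))) (x k) / poly (pderiv (node_poly n x)) (x k) =
      1 - (\<alpha> + 1) / x k + 2 * poly (pderiv S) (x k) / poly S (x k) - 2 * poly (pderiv P) (x k) / poly P (x k)"
    if k: "k \<in> {1..n}" for k
    unfolding S_def
  proof (rule exceptional_laguerre_I_ode_at_zero[OF y_Pq[unfolded q_def]])
    show "poly (node_poly n x) (x k) = 0" using k by (auto simp: node_poly_def poly_prod)
    show "poly (pderiv (node_poly n x)) (x k) \<noteq> 0" using inj k by (rule poly_pderiv_node_poly_nonzero)
  qed (use y_nz P_pos S_pos node(1)[OF k] in \<open>force simp: S_def\<close>)+
  have stable: "stable_system w {0<..} n x (grunwald_system n x)"
  proof (rule grunwald_stable[OF \<open>n \<ge> 1\<close> inj])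
    fix t :: real assume "t \<in> {0<..}"
    then have "t > 0" by simp
    have "(\<Sum>k=1..n. (poly (lagrange_basis n x k) t)\<^sup>2 *
        (exp (x k) * x k powr (- (\<alpha> + 1)) * (poly S (x k) / poly P (x k))\<^sup>2))
        \<le> exp t * t powr (- (\<alpha> + 1)) * (poly S t / poly P t)\<^sup>2"
      by (rule sum_lagrange_basis_sq_le[OF assms(2) inj node(1) \<open>t > 0\<close> assms(3) P_z S _ s(1) z_neg z(3) ode])
        simp_all
    also have "\<dots> = 1 / w t" by (rule w_inv[symmetric])
    also have "(\<Sum>k=1..n. (poly (lagrange_basis n x k) t)\<^sup>2 *
        (exp (x k) * x k powr (- (\<alpha> + 1)) * (poly S (x k) / poly P (x k))\<^sup>2)) =
        (\<Sum>k=1..n. (poly (lagrange_basis n x k) t)\<^sup>2 / w (x k))"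
      by (simp only: w_inv[symmetric]) simp
    finally show "(\<Sum>k=1..n. (poly (lagrange_basis n x k) t)\<^sup>2 / w (x k)) \<le> 1 / w t" .
  qed (use w_pos node(1) in auto)
  \<comment> \<open>The degrees compare index by index, not merely in the sum.\<close>
  moreover have "(\<Sum>k=1..n. degree (grunwald_system n x k)) \<le> (\<Sum>k=1..n. degree (l k))"
    if "stable_system w {0<..} n x l" for l
  proof (rule sum_mono)
    fix k assume k: "k \<in> {1..n}"
    have "degree (grunwald_system n x k) \<le> 2 * (n - 1)"
      using degree_power_le[of "lagrange_basis n x k" 2] degree_lagrange_basis[OF inj k]
      by (simp add: grunwald_system_def mult.commute)
    also have "\<dots> \<le> degree (l k)"
      using that inj node(1) w_pos k by (rule degree_stable_system_ge)
    finally show "degree (grunwald_system n x k) \<le> degree (l k)" .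
  qed
  ultimately show ?thesis by (simp add: most_economical_def w_def)
qed

end
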